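(* Let $\lambda$ and $m$ be positive integers and let $a,b,c$ be nonnegative integers. \begin{itemize} \item (Part 1) There exists a $(2m,\ldots,2m)$-CD of $\lambda K_{2\times m}$ (that is, a Hamilton cycle decomposition). \item (Part 2) If $2a+3b=3\lambda m$, then there exists a $((2m)^{(a)},(3m)^{(b)})$-CD of $\lambda K_{3\times m}$. \item (Part 3) If $2a+3b+4c=6\lambda m-\delta$, where $\delta=0$ if $\lambda m$ is even and $\delta=2$ if $\lambda m$ is odd, and if $(b,c)\ne(0,1)$ when $\lambda m$ is even, and $(b,c)\ne(0,0)$ when $\lambda m$ is odd, then there exists a $((2m)^{(a)},(3m)^{(b)},(4m)^{(c)})$-CD of $\lambda K_{4\times m}$. \end{itemize}
   Context: All graphs are finite, loopless and undirected, possibly with multiple (parallel) edges. $K_{n\times m}$ is the complete $n$-partite graph with all $n$ parts of cardinality $m$. For a simple graph $\mathcal G$ and a positive integer $\lambda$, $\lambda\mathcal G$ denotes the multigraph with underlying simple graph $\mathcal G$ in which every edge has multiplicity $\lambda$. A cycle of length $\ell\ge 2$ is a connected 2-regular graph with $\ell$ edges (a cycle of length 2 consists of two distinct parallel edges between two vertices). A 1-factor of a graph is a spanning 1-regular subgraph. A decomposition of a graph is a collection of its subgraphs whose edge sets partition its edge set. A $(c_1^{(m_1)},\ldots,c_s^{(m_s)})$-CD of a graph $\mathcal G$ (in which all vertex degrees are even or all are odd) is a decomposition of $\mathcal G$ into $m_1$ cycles of length $c_1$, $m_2$ cycles of length $c_2$, $\ldots$, and $m_s$ cycles of length $c_s$,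 plus a 1-factor if each vertex of $\mathcal G$ has odd degree. A $(2m,\ldots,2m)$-CD of $\mathcal G$ is such a decomposition in which all cycles have length $2m$ (again plus a 1-factor if each vertex of $\mathcal G$ has odd degree). The paper attributes Part 1 to earlier work and includes it for completeness. *)

theory Defs
  imports Main
begin

text \<open>Loopless undirected multigraphs: parallel edges are distinct edges with the same set of
  two end vertices.\<close>

record ('v, 'e) mgraph =
  verts :: "'v set"
  edges :: "'e set"
  ends :: "'e \<Rightarrow> 'v set"

definition multigraph :: "('v, 'e) mgraph \<Rightarrow> bool" where
  "multigraph G \<longleftrightarrow> finite (verts G) \<and> finite (edges G) \<and>
     (\<forall>e\<in>edges G. ends G e \<subseteq> verts G \<and> card (ends G e) = 2)"

text \<open>The function \<open>ends\<close> is inherited unchanged, also outside the edges of the subgraph, so that a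
  subgraph is determined by its vertices and edges.\<close>

definition subgraph :: "('v, 'e) mgraph \<Rightarrow> ('v, 'e) mgraph \<Rightarrow> bool" where
  "subgraph H G \<longleftrightarrow> multigraph H \<and> verts H \<subseteq> verts G \<and> edges H \<subseteq> edges G \<and> ends H = ends G"

definition deg :: "('v, 'e) mgraph \<Rightarrow> 'v \<Rightarrow> nat" where
  "deg G v = card {e \<in> edges G. v \<in> ends G e}"

definition regular :: "nat \<Rightarrow> ('v, 'e) mgraph \<Rightarrow> bool" where
  "regular d G \<longleftrightarrow> (\<forall>v\<in>verts G. deg G v = d)"

definition adj :: "('v, 'e) mgraph \<Rightarrow> ('v \<times> 'v) set" where
  "adj G = {(u, v). \<exists>e\<in>edges G. ends G e = {u, v}}"

definition connected_graph :: "('v, 'e) mgraph \<Rightarrow> bool" where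
  "connected_graph G \<longleftrightarrow> verts G \<noteq> {} \<and> (\<forall>u\<in>verts G. \<forall>v\<in>verts G. (u, v) \<in> (adj G)\<^sup>*)"

definition is_cycle :: "nat \<Rightarrow> ('v, 'e) mgraph \<Rightarrow> bool" where
  "is_cycle l C \<longleftrightarrow> l \<ge> 2 \<and> multigraph C \<and> connected_graph C \<and> regular 2 C \<and> card (edges C) = l"

definition one_factor :: "('v, 'e) mgraph \<Rightarrow> ('v, 'e) mgraph \<Rightarrow> bool" where
  "one_factor F G \<longleftrightarrow> subgraph F G \<and> verts F = verts G \<and> regular 1 F"

definition decomposition :: "('v, 'e) mgraph list \<Rightarrow> ('v, 'e) mgraph \<Rightarrow> bool" where
  "decomposition Hs G \<longleftrightarrow>
     (\<forall>H\<in>set Hs. subgraph H G) \<and>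
     (\<Union>H\<in>set Hs. edges H) = edges G \<and>
     (\<forall>i<length Hs. \<forall>j<length Hs. i \<noteq> j \<longrightarrow> edges (Hs ! i) \<inter> edges (Hs ! j) = {})"

text \<open>The list \<open>[(c\<^sub>1, m\<^sub>1), \<dots>, (c\<^sub>s, m\<^sub>s)]\<close> stands for the exponent notation
  \<open>(c\<^sub>1\<^bsup>(m\<^sub>1)\<^esup>, \<dots>, c\<^sub>s\<^bsup>(m\<^sub>s)\<^esup>)\<close>: there are \<open>m\<^sub>i\<close> cycles of length \<open>c\<^sub>i\<close>.\<close>

definition cycle_lengths :: "(nat \<times> nat) list \<Rightarrow> nat list" where
  "cycle_lengths ps = concat (map (\<lambda>(c, k). replicate k c) ps)"

definition has_CD :: "(nat \<times> nat) list \<Rightarrow> ('v, 'e) mgraph \<Rightarrow> bool" where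
  "has_CD ps G \<longleftrightarrow>
     (\<exists>Cs Fs. list_all2 is_cycle (cycle_lengths ps) Cs \<and>
        ((\<forall>v\<in>verts G. even (deg G v)) \<and> Fs = [] \<or>
         (\<forall>v\<in>verts G. odd (deg G v)) \<and> (\<exists>F. Fs = [F] \<and> one_factor F G)) \<and>
        decomposition (Cs @ Fs) G)"

text \<open>The number of cycles is not prescribed here; it may be \<open>0\<close> (a single edge is a \<open>1\<close>-factor).\<close>

definition has_uniform_CD :: "nat \<Rightarrow> ('v, 'e) mgraph \<Rightarrow> bool" where
  "has_uniform_CD c G \<longleftrightarrow> (\<exists>k. has_CD [(c, k)] G)"

text \<open>The vertex \<open>(i, x)\<close> is the \<open>x\<close>-th vertex of the \<open>i\<close>-th part. In this simple graph an edge is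
  the set of its two ends.\<close>

definition complete_multipartite :: "nat \<Rightarrow> nat \<Rightarrow> (nat \<times> nat, (nat \<times> nat) set) mgraph" where
  "complete_multipartite n m =
     \<lparr>verts = {..<n} \<times> {..<m},
      edges = {{u, v} | u v. u \<in> {..<n} \<times> {..<m} \<and> v \<in> {..<n} \<times> {..<m} \<and> fst u \<noteq> fst v},
      ends = (\<lambda>e. e)\<rparr>"

text \<open>Every edge \<open>e\<close> is replaced by the \<open>l\<close> parallel edges \<open>(e, 0), \<dots>, (e, l - 1)\<close>.\<close>

definition multiple :: "nat \<Rightarrow> ('v, 'e) mgraph \<Rightarrow> ('v, 'e \<times> nat) mgraph" where
  "multiple l G = \<lparr>verts = verts G, edges = edges G \<times> {..<l}, ends = (\<lambda>(e, k). ends G e)\<rparr>"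

lemma multigraph_multiple: "multigraph G \<Longrightarrow> multigraph (multiple l G)"
  by (auto simp: multigraph_def multiple_def)

lemma multigraph_complete_multipartite: "multigraph (complete_multipartite n m)"
proof -
  have "edges (complete_multipartite n m) \<subseteq> Pow ({..<n} \<times> {..<m})"
    by (auto simp: complete_multipartite_def)
  then have "finite (edges (complete_multipartite n m))"
    by (rule finite_subset) simp
  then show ?thesis
    by (auto simp: multigraph_def complete_multipartite_def card_2_iff)
qed

end

theory Submission
  imports Defs
begin

text \<open>The proof goes through amalgamation. Write \<open>\<lambda>\<close> for \<open>l\<close>, and contract every part of
  \<open>\<lambda>K\<^bsub>n\<times>m\<^esub>\<close> to one point: the result is \<open>\<lambda>m\<^sup>2 K\<^sub>n\<close>. Suppose that \<open>\<lambda>m K\<^sub>n\<close> decomposes into cycles of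
  lengths \<open>c\<^sub>1, \<dots>, c\<^sub>s\<close>, possibly together with a \<open>1\<close>-factor. Replacing each edge of this
  decomposition by \<open>m\<close> parallel edges turns it into an edge colouring of \<open>\<lambda>m\<^sup>2 K\<^sub>n\<close>, in which
  a cycle becomes a connected graph of degree \<open>2m\<close> and the \<open>1\<close>-factor becomes a graph of
  degree \<open>m\<close>. The theorem \<open>detachment\<close> splits every point again into \<open>m\<close> vertices, in such a way that
  vertices in different parts are joined by exactly \<open>\<lambda>\<close> edges, that every colour shares its degree out evenly, and that the colours of even degree stay connected. The
  cycle of length \<open>c\<^sub>i\<close> has then become a connected \<open>2\<close>-regular graph with \<open>m c\<^sub>i\<close> edges, that is, a
  cycle, and the colour of the \<open>1\<close>-factor has become a \<open>1\<close>-factor.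

  One vertex is split off at a time (\<open>split_vertex\<close>). The edges that move from a vertex \<open>v\<close> of weight
  \<open>n\<close> to the new vertex must form a fair \<open>n\<close>-th part of the edges at \<open>v\<close> in three respects at once:
  within each colour, within the edges towards each neighbour, and within the edges from \<open>v\<close> to each
  component of a colour minus \<open>v\<close>. The last requirement keeps a colour of even degrees connected: the
  number of edges to a component is even by the handshake lemma, so it is at least \<open>2\<close>, and for
  \<open>n \<ge> 2\<close> a fair share cannot consist of all of them. Such a selection exists by \<open>fair_selection\<close>,
  because components refine colours. Its core is the case \<open>n = 2\<close>: pair up edges inside the components and colours on the one
  hand, and inside the neighbour classes on the other hand; two matchings form a bipartite graph,
  and a proper \<open>2\<close>-colouring of it halves every class. Rebalancing any two of \<open>n\<close> shares in this way
  makes all of them fair.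

  It remains to decompose \<open>\<lambda>m K\<^sub>n\<close> for \<open>n \<le> 4\<close> into \<open>2\<close>-, \<open>3\<close>- and \<open>4\<close>-cycles in prescribed numbers,
  which is done by adding a few explicit decompositions of \<open>K\<^sub>n\<close>, \<open>2K\<^sub>n\<close> and \<open>3K\<^sub>n\<close>.\<close>

section \<open>Fair selections\<close>

lemma pairing_within_classes:
  assumes "finite S"
  shows "\<exists>\<alpha>. (\<forall>x\<in>S. \<alpha> x \<in> S \<and> \<alpha> (\<alpha> x) = x \<and> g (\<alpha> x) = g x) \<and> inj_on g {x \<in> S. \<alpha> x = x}"
  using assms
proof (induction S rule: finite_psubset_induct)
  case (psubset S)
  show ?case
  proof (cases "inj_on g S")
    case True
    then show ?thesis by (intro exI[of _ "\<lambda>x. x"]) simp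
  next
    case False
    then obtain x y where xy: "x \<in> S" "y \<in> S" "x \<noteq> y" "g x = g y"
      by (auto simp: inj_on_def)
    then obtain \<alpha> where \<alpha>:
      "\<forall>z\<in>S - {x, y}. \<alpha> z \<in> S - {x, y} \<and> \<alpha> (\<alpha> z) = z \<and> g (\<alpha> z) = g z"
      "inj_on g {z \<in> S - {x, y}. \<alpha> z = z}"
      using psubset.IH[of "S - {x, y}"] by auto
    let ?\<alpha> = "\<alpha>(x := y, y := x)"
    have "{z \<in> S. ?\<alpha> z = z} = {z \<in> S - {x, y}. \<alpha> z = z}"
      using xy by auto
    then show ?thesis
      using \<alpha> xy by (intro exI[of _ ?\<alpha>]) auto
  qed
qed

text \<open>The involutions stand for matchings, with the fixed points unmatched. All cycles of the union of two
  matchings alternate between them and hence are even. The induction contracts a pair \<open>{x, \<alpha> x}\<close> of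
  the first matching and joins the partners of its two elements in the second one.\<close>

lemma two_pairings_two_colourable:
  assumes "finite S"
    and "\<forall>x\<in>S. \<alpha> x \<in> S \<and> \<alpha> (\<alpha> x) = x"
    and "\<forall>x\<in>S. \<beta> x \<in> S \<and> \<beta> (\<beta> x) = x"
  shows "\<exists>s :: 'a \<Rightarrow> bool. \<forall>x\<in>S. (\<alpha> x \<noteq> x \<longrightarrow> s (\<alpha> x) \<noteq> s x) \<and> (\<beta> x \<noteq> x \<longrightarrow> s (\<beta> x) \<noteq> s x)"
  using assms
proof (induction S arbitrary: \<beta> rule: finite_psubset_induct)
  case (psubset S)
  show ?case
  proof (cases "\<exists>x\<in>S. \<alpha> x \<noteq> x")
    case False
    \<comment> \<open>Only \<open>\<beta>\<close> matters: single out one element of each of its pairs.\<close>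
    obtain t :: "'a \<Rightarrow> bool" where t: "\<forall>x\<in>S. \<beta> x \<noteq> x \<longrightarrow> t (\<beta> x) \<noteq> t x"
    proof -
      define t where "t x \<longleftrightarrow> x = (SOME z. z \<in> {x, \<beta> x})" for x
      have "t (\<beta> x) \<noteq> t x" if "x \<in> S" "\<beta> x \<noteq> x" for x
      proof -
        have *: "{\<beta> x, \<beta> (\<beta> x)} = {x, \<beta> x}" using psubset.prems(2) that by auto
        have "(SOME z. z \<in> {x, \<beta> x}) \<in> {x, \<beta> x}" by (rule someI_ex) auto
        then show ?thesis unfolding t_def * using that by auto
      qed
      then show thesis using that by blast
    qed
    then show ?thesis using False by blast
  next
    case True
    then obtain x where x: "x \<in> S" "\<alpha> x \<noteq> x" by auto
    define y where "y = \<alpha> x"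
    have y: "y \<in> S" "y \<noteq> x" "\<alpha> x = y" "\<alpha> y = x" using x psubset.prems(1) by (auto simp: y_def)
    define a b where "a = \<beta> x" and "b = \<beta> y"
    \<comment> \<open>After the removal of \<open>x\<close> and \<open>y\<close> their partners \<open>a\<close> and \<open>b\<close> are matched with each other; if one of
      them is itself \<open>x\<close> or \<open>y\<close>, the other one is left unmatched.\<close>
    define \<gamma> where "\<gamma> = (if a \<in> {x, y} then \<beta>(b := b) else if b \<in> {x, y} then \<beta>(a := a)
      else \<beta>(a := b, b := a))"
    have \<beta>: "\<beta> z \<in> S" "\<beta> (\<beta> z) = z" if "z \<in> S" for z using psubset.prems(2) that by auto
    have ab: "a \<in> S" "b \<in> S" "\<beta> a = x" "\<beta> b = y" "\<beta> x = a" "\<beta> y = b" "a \<noteq> b"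
      using \<beta> x y unfolding a_def b_def by metis+
    have \<gamma>: "\<forall>z\<in>S - {x, y}. \<gamma> z \<in> S - {x, y} \<and> \<gamma> (\<gamma> z) = z"
      using \<beta> ab y unfolding \<gamma>_def by (auto; metis)
    have \<alpha>: "\<forall>z\<in>S - {x, y}. \<alpha> z \<in> S - {x, y} \<and> \<alpha> (\<alpha> z) = z"
      using psubset.prems(1) y x by (metis DiffD1 DiffD2 DiffI insertE insertI1 insertI2 singletonD)
    obtain s :: "'a \<Rightarrow> bool" where s: "\<forall>z\<in>S - {x, y}. (\<alpha> z \<noteq> z \<longrightarrow> s (\<alpha> z) \<noteq> s z) \<and> (\<gamma> z \<noteq> z \<longrightarrow> s (\<gamma> z) \<noteq> s z)"
      using psubset.IH[OF _ \<alpha> \<gamma>] x by blast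
    define c where "c \<longleftrightarrow> (if a \<in> {x, y} then if b \<in> {x, y} then True else s b else \<not> s a)"
    let ?s = "s(x := c, y := \<not> c)"
    have "(\<alpha> z \<noteq> z \<longrightarrow> ?s (\<alpha> z) \<noteq> ?s z) \<and> (\<beta> z \<noteq> z \<longrightarrow> ?s (\<beta> z) \<noteq> ?s z)" if z: "z \<in> S" for z
    proof (cases "z \<in> {x, y}")
      case True
      have "s a \<noteq> s b" if "a \<notin> {x, y}" "b \<notin> {x, y}"
        using s ab that unfolding \<gamma>_def by (auto split: if_splits)
      then show ?thesis using True ab y unfolding c_def by auto
    next
      case False
      have 1: "\<alpha> z \<noteq> z \<longrightarrow> ?s (\<alpha> z) \<noteq> ?s z" using False \<alpha> s z by auto
      consider "\<beta> z = x" | "\<beta> z = y" | "\<beta> z \<notin> {x, y}" by auto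
      then have 2: "\<beta> z \<noteq> z \<longrightarrow> ?s (\<beta> z) \<noteq> ?s z"
      proof cases
        case 1
        then have "z = a" using \<beta> z a_def by metis
        then show ?thesis using False 1 y unfolding c_def by auto
      next
        case 2
        then have zb: "z = b" using \<beta> z b_def by metis
        show ?thesis
        proof (cases "a \<in> {x, y}")
          case True then show ?thesis using zb False 2 y unfolding c_def by auto
        next
          case a: False
          then have "s a \<noteq> s b" using s ab False zb unfolding \<gamma>_def by (auto split: if_splits)
          then show ?thesis using zb False 2 a y unfolding c_def by auto
        qed
      next
        case 3
        then have "\<gamma> z = \<beta> z" using ab False \<beta> z unfolding \<gamma>_def by (auto split: if_splits)
        then show ?thesis using s z False 3 by (metis DiffI fun_upd_other insertI1 insertI2)
      qed
      from 1 2 show ?thesis by blast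
    qed
    then show ?thesis by blast
  qed
qed

text \<open>The signs of paired elements cancel, and a class contains at most one unpaired element.\<close>

lemma class_sum_alternating:
  fixes s :: "'a \<Rightarrow> int"
  assumes "finite S"
    and \<alpha>: "\<forall>x\<in>S. \<alpha> x \<in> S \<and> \<alpha> (\<alpha> x) = x \<and> g (\<alpha> x) = g x"
    and inj: "inj_on g {x \<in> S. \<alpha> x = x}"
    and alt: "\<forall>x\<in>S. \<alpha> x \<noteq> x \<longrightarrow> s (\<alpha> x) = - s x"
    and sgn: "\<forall>x. s x \<in> {1, -1}"
  shows "\<bar>\<Sum>x | x \<in> S \<and> g x = y. s x\<bar> \<le> 1"
proof -
  define M where "M = {x \<in> S. g x = y \<and> \<alpha> x \<noteq> x}"
  define U where "U = {x \<in> S. g x = y \<and> \<alpha> x = x}"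
  have fin: "finite M" "finite U" using assms(1) by (auto simp: M_def U_def)
  have "(\<Sum>x\<in>M. s x) = (\<Sum>x\<in>M. s (\<alpha> x))"
    by (rule sum.reindex_bij_witness[of _ \<alpha> \<alpha>]) (use \<alpha> in \<open>auto simp: M_def\<close>)
  also have "\<dots> = (\<Sum>x\<in>M. - s x)" using alt by (intro sum.cong) (auto simp: M_def)
  finally have M: "(\<Sum>x\<in>M. s x) = 0" by (simp add: sum_negf)
  have "(\<Sum>x | x \<in> S \<and> g x = y. s x) = (\<Sum>x\<in>M \<union> U. s x)"
    by (intro sum.cong) (auto simp: M_def U_def)
  also have "\<dots> = (\<Sum>x\<in>U. s x)" using fin M by (subst sum.union_disjoint) (auto simp: M_def U_def)
  finally have eq: "(\<Sum>x | x \<in> S \<and> g x = y. s x) = (\<Sum>x\<in>U. s x)" .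
  have "U = {} \<or> (\<exists>u. U = {u})"
    using inj unfolding U_def inj_on_def by blast
  then show ?thesis using eq sgn by (auto; metis abs_1 abs_minus_cancel insertE order_refl singletonD)
qed

text \<open>Pairing first inside the classes of the finer map \<open>g\<close>, and then the remaining elements inside the
  classes of \<open>f\<close>, yields one matching that is good for both; the matching for \<open>h\<close> is independent
  of it. Signs alternating along both matchings are the required ones.\<close>

lemma balanced_signs:
  assumes "finite S" and ref: "\<And>x y. g x = g y \<Longrightarrow> f x = f y"
  shows "\<exists>s :: 'a \<Rightarrow> int. (\<forall>x. s x \<in> {1, -1}) \<and>
    (\<forall>y. \<bar>\<Sum>x | x \<in> S \<and> f x = y. s x\<bar> \<le> 1) \<and>
    (\<forall>y. \<bar>\<Sum>x | x \<in> S \<and> g x = y. s x\<bar> \<le> 1) \<and>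
    (\<forall>y. \<bar>\<Sum>x | x \<in> S \<and> h x = y. s x\<bar> \<le> 1)"
proof -
  obtain \<alpha>\<^sub>1 where 1: "\<forall>x\<in>S. \<alpha>\<^sub>1 x \<in> S \<and> \<alpha>\<^sub>1 (\<alpha>\<^sub>1 x) = x \<and> g (\<alpha>\<^sub>1 x) = g x"
    "inj_on g {x \<in> S. \<alpha>\<^sub>1 x = x}"
    using pairing_within_classes[OF assms(1), of g] by blast
  define U where "U = {x \<in> S. \<alpha>\<^sub>1 x = x}"
  have "finite U" using assms(1) by (simp add: U_def)
  then obtain \<alpha>\<^sub>2 where 2: "\<forall>x\<in>U. \<alpha>\<^sub>2 x \<in> U \<and> \<alpha>\<^sub>2 (\<alpha>\<^sub>2 x) = x \<and> f (\<alpha>\<^sub>2 x) = f x"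
    "inj_on f {x \<in> U. \<alpha>\<^sub>2 x = x}"
    using pairing_within_classes[of U f] by blast
  obtain \<beta> where b: "\<forall>x\<in>S. \<beta> x \<in> S \<and> \<beta> (\<beta> x) = x \<and> h (\<beta> x) = h x"
    "inj_on h {x \<in> S. \<beta> x = x}"
    using pairing_within_classes[OF assms(1), of h] by blast
  define \<alpha> where "\<alpha> x = (if \<alpha>\<^sub>1 x = x then \<alpha>\<^sub>2 x else \<alpha>\<^sub>1 x)" for x
  have a: "\<forall>x\<in>S. \<alpha> x \<in> S \<and> \<alpha> (\<alpha> x) = x \<and> f (\<alpha> x) = f x"
  proof
    fix x assume x: "x \<in> S"
    show "\<alpha> x \<in> S \<and> \<alpha> (\<alpha> x) = x \<and> f (\<alpha> x) = f x"
    proof (cases "\<alpha>\<^sub>1 x = x")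
      case True
      then have "x \<in> U" using x by (simp add: U_def)
      then have "\<alpha>\<^sub>2 x \<in> U" "\<alpha>\<^sub>2 (\<alpha>\<^sub>2 x) = x" "f (\<alpha>\<^sub>2 x) = f x" using 2 by auto
      then show ?thesis using True by (auto simp: \<alpha>_def U_def)
    next
      case False
      have "\<alpha>\<^sub>1 x \<in> S" "\<alpha>\<^sub>1 (\<alpha>\<^sub>1 x) = x" "g (\<alpha>\<^sub>1 x) = g x" using 1 x by auto
      moreover from this(3) have "f (\<alpha>\<^sub>1 x) = f x" by (rule ref)
      ultimately show ?thesis using False by (auto simp: \<alpha>_def)
    qed
  qed
  have "{x \<in> S. \<alpha> x = x} = {x \<in> U. \<alpha>\<^sub>2 x = x}" by (auto simp: \<alpha>_def U_def)
  then have a': "inj_on f {x \<in> S. \<alpha> x = x}" using 2(2) by simp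
  have "\<forall>x\<in>S. \<alpha> x \<in> S \<and> \<alpha> (\<alpha> x) = x" "\<forall>x\<in>S. \<beta> x \<in> S \<and> \<beta> (\<beta> x) = x"
    using a b(1) by simp_all
  from two_pairings_two_colourable[OF assms(1) this] obtain t :: "'a \<Rightarrow> bool" where
    t: "\<forall>x\<in>S. (\<alpha> x \<noteq> x \<longrightarrow> t (\<alpha> x) \<noteq> t x) \<and> (\<beta> x \<noteq> x \<longrightarrow> t (\<beta> x) \<noteq> t x)"
    by (rule exE)
  define s :: "'a \<Rightarrow> int" where "s x = (if t x then 1 else -1)" for x
  have sgn: "\<forall>x. s x \<in> {1, -1}" by (simp add: s_def)
  have sa: "\<forall>x\<in>S. \<alpha> x \<noteq> x \<longrightarrow> s (\<alpha> x) = - s x" and sb: "\<forall>x\<in>S. \<beta> x \<noteq> x \<longrightarrow> s (\<beta> x) = - s x"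
    using t by (auto simp: s_def)
  have s1: "\<forall>x\<in>S. \<alpha>\<^sub>1 x \<noteq> x \<longrightarrow> s (\<alpha>\<^sub>1 x) = - s x" using sa by (auto simp: \<alpha>_def)
  show ?thesis
  proof (intro exI[of _ s] conjI allI)
    show "\<bar>\<Sum>x | x \<in> S \<and> f x = y. s x\<bar> \<le> 1" for y
      by (rule class_sum_alternating[OF assms(1) a a' sa sgn])
    show "\<bar>\<Sum>x | x \<in> S \<and> g x = y. s x\<bar> \<le> 1" for y
      by (rule class_sum_alternating[OF assms(1) 1 s1 sgn])
    show "\<bar>\<Sum>x | x \<in> S \<and> h x = y. s x\<bar> \<le> 1" for y
      by (rule class_sum_alternating[OF assms(1) b sb sgn])
  qed (rule sgn[rule_format])
qed

text \<open>A colouring with \<open>n\<close> colours that minimises the sum of the squares of all colour class sizes is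
  equitable. If two colours were unbalanced on some \<open>P\<close>, splitting their union anew by balanced signs
  would lower the sum of squares on \<open>P\<close> and raise it nowhere.\<close>

lemma equitable_colouring:
  fixes S :: "'a set" and \<P> :: "'a set set" and n :: nat
  assumes fin: "finite S" "finite \<P>" and "n > 0"
    and split: "\<And>S'. S' \<subseteq> S \<Longrightarrow>
      \<exists>s :: 'a \<Rightarrow> int. (\<forall>x. s x \<in> {1, -1}) \<and> (\<forall>P\<in>\<P>. \<bar>\<Sum>x\<in>P \<inter> S'. s x\<bar> \<le> 1)"
  shows "\<exists>c. (\<forall>x\<in>S. c x < n) \<and> (\<forall>P\<in>\<P>. \<forall>i<n. \<forall>j<n.
    card {x \<in> P \<inter> S. c x = i} \<le> card {x \<in> P \<inter> S. c x = j} + (1::nat))"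
proof -
  define N where "N c P i = card {x \<in> P \<inter> S. c x = i}" for c :: "'a \<Rightarrow> nat" and P i
  define pot where "pot c = (\<Sum>P\<in>\<P>. \<Sum>i<n. (N c P i)\<^sup>2)" for c
  obtain c where c: "\<forall>x\<in>S. c x < n" and min: "\<And>d. \<forall>x\<in>S. d x < n \<Longrightarrow> pot c \<le> pot d"
    using ex_has_least_nat[of "\<lambda>c. \<forall>x\<in>S. c x < n" "\<lambda>_. 0" pot] \<open>n > 0\<close> by auto
  have "N c P\<^sub>0 i \<le> N c P\<^sub>0 j + 1" if P0: "P\<^sub>0 \<in> \<P>" and ij: "i < n" "j < n" for P\<^sub>0 i j
  proof (rule ccontr)
    assume neg: "\<not> N c P\<^sub>0 i \<le> N c P\<^sub>0 j + 1"
    then have "i \<noteq> j" by auto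
    define S' where "S' = {x \<in> S. c x = i \<or> c x = j}"
    obtain s :: "'a \<Rightarrow> int" where s: "\<forall>x. s x \<in> {1, -1}" "\<forall>P\<in>\<P>. \<bar>\<Sum>x\<in>P \<inter> S'. s x\<bar> \<le> 1"
      using split[of S'] by (auto simp: S'_def)
    define d where "d x = (if x \<in> S' then if s x = 1 then i else j else c x)" for x
    have d: "\<forall>x\<in>S. d x < n" using c ij by (auto simp: d_def)
    have sum2: "N d P i + N d P j = N c P i + N c P j" for P
    proof -
      have "N d P i + N d P j = card {x \<in> P \<inter> S. d x = i \<or> d x = j}"
        unfolding N_def using fin \<open>i \<noteq> j\<close> by (subst card_Un_disjoint[symmetric]) (auto intro: arg_cong[of _ _ card])
      also have "{x \<in> P \<inter> S. d x = i \<or> d x = j} = {x \<in> P \<inter> S. c x = i \<or> c x = j}"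
        by (auto simp: d_def S'_def)
      also have "card \<dots> = N c P i + N c P j"
        unfolding N_def using fin \<open>i \<noteq> j\<close> by (subst card_Un_disjoint[symmetric]) (auto intro: arg_cong[of _ _ card])
      finally show ?thesis .
    qed
    have close: "\<bar>int (N d P i) - int (N d P j)\<bar> \<le> 1" if "P \<in> \<P>" for P
    proof -
      let ?A = "{x \<in> P \<inter> S. d x = i}" and ?B = "{x \<in> P \<inter> S. d x = j}"
      have "P \<inter> S' = ?A \<union> ?B" using \<open>i \<noteq> j\<close> by (auto simp: d_def S'_def)
      then have "(\<Sum>x\<in>P \<inter> S'. s x) = (\<Sum>x\<in>?A. s x) + (\<Sum>x\<in>?B. s x)"
        using fin \<open>i \<noteq> j\<close> by (subst sum.union_disjoint[symmetric]) auto
      also have "(\<Sum>x\<in>?A. s x) = (\<Sum>x\<in>?A. 1)"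
        using \<open>i \<noteq> j\<close> by (intro sum.cong) (auto simp: d_def S'_def split: if_splits)
      also have "(\<Sum>x\<in>?B. s x) = (\<Sum>x\<in>?B. -1)"
        using \<open>i \<noteq> j\<close> s(1) by (intro sum.cong) (auto simp: d_def S'_def split: if_splits)
      finally show ?thesis using s(2) that unfolding N_def by auto
    qed
    have rest: "N d P k = N c P k" if "k \<noteq> i" "k \<noteq> j" for P k
    proof -
      have "{x \<in> P \<inter> S. d x = k} = {x \<in> P \<inter> S. c x = k}"
        using that by (auto simp: d_def S'_def)
      then show ?thesis by (simp add: N_def)
    qed
    have expand: "(\<Sum>k<n. (N e P k)\<^sup>2) = (N e P i)\<^sup>2 + (N e P j)\<^sup>2 + (\<Sum>k\<in>{..<n} - {i, j}. (N e P k)\<^sup>2)" for e P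
    proof -
      have "{..<n} - {i, j} = {..<n} - {i} - {j}" by auto
      then show ?thesis using ij \<open>i \<noteq> j\<close>
        by (simp add: sum.remove[of "{..<n}" i] sum.remove[of "{..<n} - {i}" j])
    qed
    \<comment> \<open>Twice \<open>p\<^sup>2 + q\<^sup>2\<close> is \<open>(p + q)\<^sup>2 + (p - q)\<^sup>2\<close>, so for a given sum only the difference matters. Sum
      and difference have the same parity, so no difference is smaller than one of at most \<open>1\<close>.\<close>
    have sq: "p\<^sup>2 + q\<^sup>2 \<le> p'\<^sup>2 + q'\<^sup>2"
      "\<not> p' \<le> q' + 1 \<Longrightarrow> p\<^sup>2 + q\<^sup>2 < p'\<^sup>2 + q'\<^sup>2"
      if "p + q = p' + q'" "\<bar>int p - int q\<bar> \<le> 1" for p q p' q' :: nat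
    proof -
      have e: "2 * ((int x)\<^sup>2 + (int y)\<^sup>2) = (int (x + y))\<^sup>2 + (int x - int y)\<^sup>2" for x y
        by (simp add: power2_eq_square algebra_simps)
      have le1: "(int p - int q)\<^sup>2 \<le> 1" using that(2) by (simp add: abs_square_le_1)
      have par: "(int p - int q)\<^sup>2 \<le> (int p' - int q')\<^sup>2"
      proof (cases "p' = q'")
        case True
        then have "even (p + q)" using that by simp
        then have "p = q" using that(2) by presburger
        then show ?thesis by simp
      next
        case False
        then have "(int p' - int q')\<^sup>2 \<noteq> 0" by simp
        moreover have "(int p' - int q')\<^sup>2 \<ge> 0" by simp
        ultimately show ?thesis using le1 by linarith
      qed
      have "2 * ((int p)\<^sup>2 + (int q)\<^sup>2) \<le> 2 * ((int p')\<^sup>2 + (int q')\<^sup>2)"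
        unfolding e using par that(1) by simp
      then have "int (p\<^sup>2 + q\<^sup>2) \<le> int (p'\<^sup>2 + q'\<^sup>2)" by simp
      then show "p\<^sup>2 + q\<^sup>2 \<le> p'\<^sup>2 + q'\<^sup>2" by linarith
      assume "\<not> p' \<le> q' + 1"
      then have "int p' - int q' \<ge> 2" by linarith
      then have "(int p' - int q')\<^sup>2 \<ge> 2\<^sup>2" by (intro power_mono) auto
      then have "2 * ((int p)\<^sup>2 + (int q)\<^sup>2) < 2 * ((int p')\<^sup>2 + (int q')\<^sup>2)"
        unfolding e using le1 that(1) by simp
      then have "int (p\<^sup>2 + q\<^sup>2) < int (p'\<^sup>2 + q'\<^sup>2)" by simp
      then show "p\<^sup>2 + q\<^sup>2 < p'\<^sup>2 + q'\<^sup>2" by linarith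
    qed
    have "pot d < pot c" unfolding pot_def
    proof (rule sum_strict_mono_ex1)
      show "\<forall>P\<in>\<P>. (\<Sum>k<n. (N d P k)\<^sup>2) \<le> (\<Sum>k<n. (N c P k)\<^sup>2)"
        unfolding expand using rest sq(1)[OF sum2 close] by auto
      show "\<exists>P\<in>\<P>. (\<Sum>k<n. (N d P k)\<^sup>2) < (\<Sum>k<n. (N c P k)\<^sup>2)"
        unfolding expand using rest sq(2)[OF sum2 close[OF P0] neg] P0 by (intro bexI[of _ P\<^sub>0]) auto
    qed (rule fin)
    then show False using min[OF d] by linarith
  qed
  then show ?thesis using c unfolding N_def by blast
qed

text \<open>The two inequalities say that \<open>card (P \<inter> T)\<close> is \<open>card (P \<inter> S) / n\<close>, rounded down or up. This is the
  special case of the Nash-Williams lemma on two laminar families in which one family consists of the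
  classes of two nested equivalence relations and the other one of the classes of a single relation.
  \<open>T\<close> is one class of an equitable \<open>n\<close>-colouring.\<close>

lemma fair_selection:
  assumes "finite S" and "n > 0" and ref: "\<And>x y. g x = g y \<Longrightarrow> f x = f y"
  shows "\<exists>T\<subseteq>S. \<forall>P \<in> range (\<lambda>y. {x. f x = y}) \<union> range (\<lambda>y. {x. g x = y}) \<union> range (\<lambda>y. {x. h x = y}).
    n * card (P \<inter> T) < card (P \<inter> S) + n \<and> card (P \<inter> S) < n * card (P \<inter> T) + n"
proof -
  define \<Q> where "\<Q> = range (\<lambda>y. {x. f x = y}) \<union> range (\<lambda>y. {x. g x = y}) \<union> range (\<lambda>y. {x. h x = y})"
  define \<P> where "\<P> = (\<lambda>P. P \<inter> S) ` \<Q>"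
  have "finite \<P>" by (rule finite_subset[of _ "Pow S"]) (use assms in \<open>auto simp: \<P>_def\<close>)
  moreover have "\<exists>s :: 'a \<Rightarrow> int. (\<forall>x. s x \<in> {1, -1}) \<and> (\<forall>P\<in>\<P>. \<bar>\<Sum>x\<in>P \<inter> S'. s x\<bar> \<le> 1)"
    if S': "S' \<subseteq> S" for S'
  proof -
    have "finite S'" using S' assms(1) finite_subset by blast
    then obtain s :: "'a \<Rightarrow> int" where s: "\<forall>x. s x \<in> {1, -1}"
      "\<And>y. \<bar>\<Sum>x | x \<in> S' \<and> f x = y. s x\<bar> \<le> 1"
      "\<And>y. \<bar>\<Sum>x | x \<in> S' \<and> g x = y. s x\<bar> \<le> 1"
      "\<And>y. \<bar>\<Sum>x | x \<in> S' \<and> h x = y. s x\<bar> \<le> 1"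
      using balanced_signs[where f = f and g = g and h = h, OF \<open>finite S'\<close> ref] by auto
    have eq: "{x. k x = y} \<inter> S \<inter> S' = {x. x \<in> S' \<and> k x = y}" for k :: "'a \<Rightarrow> 'z" and y using S' by auto
    have "\<bar>\<Sum>x\<in>P \<inter> S'. s x\<bar> \<le> 1" if "P \<in> \<P>" for P
    proof -
      from that consider y where "P = {x. f x = y} \<inter> S" | y where "P = {x. g x = y} \<inter> S"
        | y where "P = {x. h x = y} \<inter> S"
        unfolding \<P>_def \<Q>_def by blast
      then show ?thesis
        by cases (simp_all only: eq s)
    qed
    then show ?thesis using s(1) by blast
  qed
  ultimately have "\<exists>c. (\<forall>x\<in>S. c x < n) \<and> (\<forall>P\<in>\<P>. \<forall>i<n. \<forall>j<n.
      card {x \<in> P \<inter> S. c x = i} \<le> card {x \<in> P \<inter> S. c x = j} + (1::nat))"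
    by (intro equitable_colouring assms)
  then obtain c where c: "\<forall>x\<in>S. c x < n" "\<forall>P\<in>\<P>. \<forall>i<n. \<forall>j<n.
      card {x \<in> P \<inter> S. c x = i} \<le> card {x \<in> P \<inter> S. c x = j} + (1::nat)"
    by blast
  define T where "T = {x \<in> S. c x = 0}"
  have "n * card (P \<inter> T) < card (P \<inter> S) + n \<and> card (P \<inter> S) < n * card (P \<inter> T) + n" if "P \<in> \<Q>" for P
  proof -
    define N where "N i = card {x \<in> P \<inter> S. c x = i}" for i
    have N: "N i \<le> N j + 1" if "i < n" "j < n" for i j
      using c(2)[unfolded \<P>_def] \<open>P \<in> \<Q>\<close> that unfolding N_def by auto
    have T: "card (P \<inter> T) = N 0" unfolding N_def T_def by (intro arg_cong[of _ _ card]) auto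
    have "P \<inter> S = (\<Union>i\<in>{..<n}. {x \<in> P \<inter> S. c x = i})" using c(1) by auto
    also have "card \<dots> = (\<Sum>i<n. N i)"
      unfolding N_def using assms(1) by (intro card_UN_disjoint) auto
    also have "\<dots> = N 0 + (\<Sum>i\<in>{..<n} - {0}. N i)" using \<open>n > 0\<close> by (intro sum.remove) auto
    finally have sum: "card (P \<inter> S) = N 0 + (\<Sum>i\<in>{..<n} - {0}. N i)" .
    have "(\<Sum>i\<in>{..<n} - {0}. N i) \<le> (\<Sum>i\<in>{..<n} - {0}. N 0 + 1)"
      using N \<open>n > 0\<close> by (intro sum_mono) auto
    moreover have "(\<Sum>i\<in>{..<n} - {0}. N 0) \<le> (\<Sum>i\<in>{..<n} - {0}. N i + 1)"
      using N \<open>n > 0\<close> by (intro sum_mono) auto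
    moreover have "card ({..<n} - {0}) = n - 1" by (simp add: \<open>n > 0\<close>)
    ultimately have "(\<Sum>i\<in>{..<n} - {0}. N i) \<le> (n - 1) * (N 0 + 1)"
      "(n - 1) * N 0 \<le> (\<Sum>i\<in>{..<n} - {0}. N i) + (n - 1)"
      by (simp_all add: sum.distrib sum_Suc)
    moreover obtain k where "n = Suc k" using \<open>n > 0\<close> gr0_implies_Suc by auto
    ultimately show ?thesis using sum T by (simp add: algebra_simps)
  qed
  then show ?thesis unfolding \<Q>_def by (intro exI[of _ T]) (auto simp: T_def)
qed

section \<open>Splitting off a vertex\<close>

definition colour_adj :: "'e set \<Rightarrow> ('e \<Rightarrow> nat) \<Rightarrow> ('e \<Rightarrow> 'v set) \<Rightarrow> nat \<Rightarrow> ('v \<times> 'v) set" where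
  "colour_adj E col en \<kappa> = {(x, y). \<exists>e\<in>E. col e = \<kappa> \<and> en e = {x, y}}"

lemma sym_colour_adj: "sym (colour_adj E col en \<kappa>)"
  by (auto simp: sym_def colour_adj_def insert_commute)

text \<open>In a coloured multigraph whose vertices are distributed over parts, \<open>r \<kappa> i\<close> is the degree of the
  colour \<open>\<kappa>\<close> that is intended for the vertices in part \<open>i\<close>. The edges and their colours stay fixed
  during the whole process; only the map that assigns to an edge its ends changes.\<close>

locale edge_coloured =
  fixes E :: "'e set" and col :: "'e \<Rightarrow> nat" and l :: nat and part :: "'v \<Rightarrow> nat"
    and r :: "nat \<Rightarrow> nat \<Rightarrow> nat"
  assumes finite_E: "finite E"
begin

text \<open>A vertex \<open>v\<close> of weight \<open>w v\<close> represents \<open>w v\<close> vertices that have not been separated yet. So all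
  multiplicities and colour degrees are those that arise from a graph with the intended multiplicity
  \<open>l\<close> and degrees \<open>r\<close> by merging vertices of the same part. Connectedness is only claimed for the
  colours with even degrees: it survives splitting for them, whereas the \<open>1\<close>-factor is to
  fall apart.\<close>

definition amalgam :: "'v set \<Rightarrow> ('v \<Rightarrow> nat) \<Rightarrow> ('e \<Rightarrow> 'v set) \<Rightarrow> bool" where
  "amalgam V w en \<longleftrightarrow> finite V \<and> (\<forall>v\<in>V. w v > 0) \<and>
     (\<forall>e\<in>E. en e \<subseteq> V \<and> card (en e) = 2) \<and>
     (\<forall>u\<in>V. \<forall>v\<in>V. u \<noteq> v \<longrightarrow>
        card {e \<in> E. en e = {u, v}} = (if part u = part v then 0 else l * w u * w v)) \<and>
     (\<forall>v\<in>V. \<forall>\<kappa>. card {e \<in> E. col e = \<kappa> \<and> v \<in> en e} = r \<kappa> (part v) * w v) \<and>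
     (\<forall>\<kappa>. (\<forall>i. even (r \<kappa> i)) \<longrightarrow> (\<forall>u\<in>V. \<forall>v\<in>V. r \<kappa> (part u) > 0 \<longrightarrow> r \<kappa> (part v) > 0 \<longrightarrow>
        (u, v) \<in> (colour_adj E col en \<kappa>)\<^sup>*))"

text \<open>The handshake lemma in a union \<open>W\<close> of components of the colour minus \<open>v\<close>: modulo \<open>2\<close>, the degree
  sum over \<open>W\<close> counts the edges with exactly one end in \<open>W\<close>, and these are the edges between \<open>W\<close>
  and \<open>v\<close>.\<close>

lemma even_component_edges:
  assumes "finite V" and en: "\<forall>e\<in>E. en e \<subseteq> V \<and> card (en e) = 2"
    and even_deg: "\<forall>u\<in>V. even (card {e \<in> E. col e = \<kappa> \<and> u \<in> en e})"
    and "W \<subseteq> V" "v \<notin> W"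
    and closed: "\<And>e x y. e \<in> E \<Longrightarrow> col e = \<kappa> \<Longrightarrow> en e = {x, y} \<Longrightarrow> x \<in> W \<Longrightarrow> y \<noteq> v \<Longrightarrow> y \<in> W"
  shows "even (card {e \<in> E. col e = \<kappa> \<and> v \<in> en e \<and> en e - {v} \<subseteq> W})"
proof -
  define F where "F = {e \<in> E. col e = \<kappa>}"
  have fin: "finite F" "finite W" using finite_E assms(1,4) finite_subset by (auto simp: F_def)
  have "(\<Sum>u\<in>W. card {e \<in> F. u \<in> en e}) = (\<Sum>u\<in>W. \<Sum>e\<in>F. if u \<in> en e then 1 else 0)"
    using fin by (simp add: sum.If_cases Int_def)
  also have "\<dots> = (\<Sum>e\<in>F. \<Sum>u\<in>W. if u \<in> en e then 1 else 0)"
    by (rule sum.swap)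
  also have "\<dots> = (\<Sum>e\<in>F. card (W \<inter> en e))"
    using fin by (simp add: sum.If_cases Int_def)
  finally have "(\<Sum>e\<in>F. card (W \<inter> en e)) = (\<Sum>u\<in>W. card {e \<in> F. u \<in> en e})" by simp
  moreover have "even (\<Sum>u\<in>W. card {e \<in> F. u \<in> en e})"
    using even_deg assms(4) by (intro dvd_sum) (auto simp: F_def conj_assoc)
  ultimately have "even (\<Sum>e\<in>F. card (W \<inter> en e))" by simp
  then have "even (card {e \<in> F. odd (card (W \<inter> en e))})" using fin even_sum_iff by metis
  moreover have "odd (card (W \<inter> en e)) \<longleftrightarrow> v \<in> en e \<and> en e - {v} \<subseteq> W" if "e \<in> F" for e
  proof -
    have e: "e \<in> E" "col e = \<kappa>" using that by (auto simp: F_def)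
    then obtain x y where xy: "en e = {x, y}" "x \<noteq> y" using en by (meson card_2_iff)
    have 1: "x \<in> W \<Longrightarrow> y \<noteq> v \<Longrightarrow> y \<in> W" using closed[OF e xy(1)] .
    have 2: "y \<in> W \<Longrightarrow> x \<noteq> v \<Longrightarrow> x \<in> W" using closed[OF e, of y x] xy by (simp add: insert_commute)
    have c: "card (W \<inter> en e) = (if x \<in> W then 1 else 0) + (if y \<in> W then 1 else 0)"
      using xy by (simp add: Int_insert_right)
    show ?thesis unfolding c unfolding xy(1)
      using xy(2) 1 2 \<open>v \<notin> W\<close> by (cases "x = v"; cases "y = v"; cases "x \<in> W"; cases "y \<in> W") (simp_all add: insert_Diff_if)
  qed
  then have "{e \<in> F. odd (card (W \<inter> en e))} = {e \<in> E. col e = \<kappa> \<and> v \<in> en e \<and> en e - {v} \<subseteq> W}"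
    by (auto simp: F_def)
  ultimately show ?thesis by simp
qed

text \<open>The edges in \<open>T\<close>, a fair selection from the edges at \<open>v\<close>, are moved from \<open>v\<close> to \<open>v'\<close>. Fairness
  within colours and within the edges to each neighbour gives the degrees and multiplicities.
  Fairness within components gives connectedness: some component contains the other ends both of a
  moved edge and of an edge that stays, which links \<open>v'\<close> to \<open>v\<close>; every remaining vertex reaches \<open>v\<close> or
  \<open>v'\<close> inside its own component.\<close>

lemma split_vertex:
  assumes am: "amalgam V w en" and v: "v \<in> V" "w v \<ge> 2" and v': "v' \<notin> V" "part v' = part v"
  shows "\<exists>en'. amalgam (insert v' V) (w(v := w v - 1, v' := 1)) en'"
proof -
  note parts = am[unfolded amalgam_def]
  from parts have fin: "finite V" by (elim conjE)
  from parts have pos: "\<forall>u\<in>V. w u > 0" by (elim conjE)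
  from parts have en: "\<forall>e\<in>E. en e \<subseteq> V \<and> card (en e) = 2" by (elim conjE)
  from parts have mult: "card {e \<in> E. en e = {x, y}} = (if part x = part y then 0 else l * w x * w y)"
    if "x \<in> V" "y \<in> V" "x \<noteq> y" for x y
    using that by (elim conjE) blast
  from parts have deg: "card {e \<in> E. col e = \<kappa> \<and> x \<in> en e} = r \<kappa> (part x) * w x" if "x \<in> V" for x \<kappa>
    using that by (elim conjE) blast
  from parts have conn: "(x, y) \<in> (colour_adj E col en \<kappa>)\<^sup>*"
    if "\<forall>i. even (r \<kappa> i)" "x \<in> V" "y \<in> V" "r \<kappa> (part x) > 0" "r \<kappa> (part y) > 0" for \<kappa> x y
    using that by (elim conjE) blast
  define n where "n = w v"
  have n: "n \<ge> 2" using v by (simp add: n_def)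
  define S where "S = {e \<in> E. v \<in> en e}"
  have finS: "finite S" using finite_E by (simp add: S_def)
  have other: "\<exists>z. en e = {v, z} \<and> z \<noteq> v \<and> z \<in> V" if "e \<in> S" for e
  proof -
    have "en e \<subseteq> V" "card (en e) = 2" "v \<in> en e" using that en by (auto simp: S_def)
    then obtain x y where xy: "en e = {x, y}" "x \<noteq> y" by (meson card_2_iff)
    show ?thesis
    proof (cases "v = x")
      case True
      then show ?thesis using xy \<open>en e \<subseteq> V\<close> by (intro exI[of _ y]) simp
    next
      case False
      then have "v = y" using xy \<open>v \<in> en e\<close> by simp
      then show ?thesis using xy \<open>en e \<subseteq> V\<close> by (intro exI[of _ x]) (simp add: insert_commute)
    qed
  qed
  \<comment> \<open>\<open>R \<kappa>\<close> is the colour \<open>\<kappa>\<close> minus \<open>v\<close>; \<open>g\<close> maps an edge at \<open>v\<close> to its colour and the component of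
    its other end.\<close>
  define R where "R \<kappa> = {(x, y). x \<noteq> v \<and> y \<noteq> v \<and> (x, y) \<in> colour_adj E col en \<kappa>}" for \<kappa>
  have symR: "sym ((R \<kappa>)\<^sup>*)" for \<kappa>
    using sym_colour_adj[of E col en \<kappa>] by (intro sym_rtrancl) (auto simp: sym_def R_def)
  define h where "h e = en e - {v}" for e
  define g where "g e = (col e, (R (col e))\<^sup>* `` h e)" for e
  obtain T where TS: "T \<subseteq> S" and
    Tf: "\<And>\<kappa>. n * card ({e. col e = \<kappa>} \<inter> T) < card ({e. col e = \<kappa>} \<inter> S) + n \<and>
          card ({e. col e = \<kappa>} \<inter> S) < n * card ({e. col e = \<kappa>} \<inter> T) + n" and
    Tg: "\<And>y. n * card ({e. g e = y} \<inter> T) < card ({e. g e = y} \<inter> S) + n" and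
    Th: "\<And>y. n * card ({e. h e = y} \<inter> T) < card ({e. h e = y} \<inter> S) + n \<and>
          card ({e. h e = y} \<inter> S) < n * card ({e. h e = y} \<inter> T) + n"
  proof -
    have "n > 0" using n by simp
    have "g x = g y \<Longrightarrow> col x = col y" for x y by (simp add: g_def)
    from fair_selection[where f = col and g = g and h = h, OF finS \<open>n > 0\<close> this]
    obtain T where T: "T \<subseteq> S" "\<forall>P \<in> range (\<lambda>y. {x. col x = y}) \<union> range (\<lambda>y. {x. g x = y}) \<union> range (\<lambda>y. {x. h x = y}).
      n * card (P \<inter> T) < card (P \<inter> S) + n \<and> card (P \<inter> S) < n * card (P \<inter> T) + n" by blast
    show thesis by (rule that[OF T(1)]) (use T(2) in blast)+
  qed
  \<comment> \<open>Wherever \<open>n\<close> divides the size of a class, rounding has no effect.\<close>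
  have exact: "t = q" if "n * t < n * q + n" "n * q < n * t + n" for t q :: nat
  proof -
    have "n * t < n * Suc q" "n * q < n * Suc t" using that by (simp_all add: algebra_simps)
    then have "t < Suc q" "q < Suc t" by (simp_all only: mult_less_cancel1)
    then show ?thesis by simp
  qed
  have cardTcol: "card {e \<in> T. col e = \<kappa>} = r \<kappa> (part v)" for \<kappa>
  proof (rule exact)
    have "{e. col e = \<kappa>} \<inter> S = {e \<in> E. col e = \<kappa> \<and> v \<in> en e}" by (auto simp: S_def)
    then have "card ({e. col e = \<kappa>} \<inter> S) = n * r \<kappa> (part v)" using deg[OF v(1)] by (simp add: n_def)
    moreover have "{e. col e = \<kappa>} \<inter> T = {e \<in> T. col e = \<kappa>}" by auto
    ultimately show "n * card {e \<in> T. col e = \<kappa>} < n * r \<kappa> (part v) + n"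
      "n * r \<kappa> (part v) < n * card {e \<in> T. col e = \<kappa>} + n" using Tf[of \<kappa>] by simp_all
  qed
  have cardTz: "card {e \<in> T. en e = {v, z}} = (if part v = part z then 0 else l * w z)"
    if z: "z \<in> V" "z \<noteq> v" for z
  proof (rule exact)
    have "{e. h e = {z}} \<inter> S = {e \<in> E. en e = {v, z}}" "{e. h e = {z}} \<inter> T = {e \<in> T. en e = {v, z}}"
      using TS z by (auto simp: S_def h_def)
    moreover have "card {e \<in> E. en e = {v, z}} = n * (if part v = part z then 0 else l * w z)"
      using mult[OF v(1) z(1)] z by (simp add: n_def)
    ultimately show "n * card {e \<in> T. en e = {v, z}} < n * (if part v = part z then 0 else l * w z) + n"
      "n * (if part v = part z then 0 else l * w z) < n * card {e \<in> T. en e = {v, z}} + n"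
      using Th[of "{z}"] by simp_all
  qed
  define en' where "en' e = (if e \<in> T then insert v' (en e - {v}) else en e)" for e
  have vv: "v \<noteq> v'" using v v' by auto
  have T': "\<exists>z. en e = {v, z} \<and> en' e = {v', z} \<and> z \<noteq> v \<and> z \<noteq> v' \<and> z \<in> V" if "e \<in> T" for e
  proof -
    obtain z where "en e = {v, z}" "z \<noteq> v" "z \<in> V" using other TS \<open>e \<in> T\<close> by blast
    moreover from this have "en' e = {v', z}" using that by (auto simp: en'_def)
    ultimately show ?thesis using v' by (intro exI[of _ z]) auto
  qed
  have en'V: "\<forall>e\<in>E. en' e \<subseteq> insert v' V \<and> card (en' e) = 2"
  proof
    fix e assume "e \<in> E"
    show "en' e \<subseteq> insert v' V \<and> card (en' e) = 2"
    proof (cases "e \<in> T")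
      case True
      then obtain z where "en' e = {v', z}" "z \<noteq> v'" "z \<in> V" using T' by blast
      then show ?thesis by auto
    next
      case False
      then show ?thesis using en \<open>e \<in> E\<close> by (auto simp: en'_def)
    qed
  qed
  have notv': "v' \<notin> en e" if "e \<in> E" for e using en that v'(1) by auto
  have TE: "T \<subseteq> E" using TS by (auto simp: S_def)
  have finT: "finite T" using TE finite_E finite_subset by blast
  let ?w = "w(v := w v - 1, v' := 1)"
  have mult_v: "card {e \<in> E. en' e = {v, z}} = (if part v = part z then 0 else l * (n - 1) * w z)"
    and mult_v': "card {e \<in> E. en' e = {v', z}} = (if part v = part z then 0 else l * w z)"
    if z: "z \<in> V" "z \<noteq> v" for z
  proof -
    have zv': "z \<noteq> v'" using z v' by auto
    have "{e \<in> E. en' e = {v', z}} = {e \<in> T. en e = {v, z}}"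
      using TE T' notv' zv' z by (auto simp: en'_def doubleton_eq_iff; blast)
    then show "card {e \<in> E. en' e = {v', z}} = (if part v = part z then 0 else l * w z)"
      using cardTz[OF z] by simp
    have "{e \<in> E. en' e = {v, z}} = {e \<in> E. en e = {v, z}} - {e \<in> T. en e = {v, z}}"
      using TE T' zv' z vv by (auto simp: en'_def doubleton_eq_iff)
    then have "card {e \<in> E. en' e = {v, z}} = card {e \<in> E. en e = {v, z}} - card {e \<in> T. en e = {v, z}}"
      using TE finT by (simp add: card_Diff_subset subset_iff)
    then show "card {e \<in> E. en' e = {v, z}} = (if part v = part z then 0 else l * (n - 1) * w z)"
      using cardTz[OF z] mult[OF v(1) z(1)] z by (simp add: n_def diff_mult_distrib diff_mult_distrib2)
  qed
  have mult_vv: "card {e \<in> E. en' e = {v, v'}} = 0"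
  proof -
    have "{e \<in> E. en' e = {v, v'}} = {}"
      using T' notv' vv by (auto simp: en'_def doubleton_eq_iff; blast)
    then show ?thesis by (simp only: card.empty)
  qed
  have mult_other: "card {e \<in> E. en' e = {x, y}} = (if part x = part y then 0 else l * w x * w y)"
    if "x \<in> V" "y \<in> V" "x \<noteq> y" "x \<noteq> v" "y \<noteq> v" for x y
  proof -
    have "x \<noteq> v'" "y \<noteq> v'" using that v' by auto
    have "en' e = {x, y} \<longleftrightarrow> en e = {x, y}" for e
    proof (cases "e \<in> T")
      case True
      then obtain z where "en e = {v, z}" "en' e = {v', z}" using T' by blast
      then show ?thesis using that(4,5) \<open>x \<noteq> v'\<close> \<open>y \<noteq> v'\<close> by (simp add: doubleton_eq_iff)
    qed (simp add: en'_def)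
    then show ?thesis using mult that by simp
  qed
  have mult': "card {e \<in> E. en' e = {x, y}} = (if part x = part y then 0 else l * ?w x * ?w y)"
    if xy: "x \<in> insert v' V" "y \<in> insert v' V" "x \<noteq> y" for x y
  proof -
    have V: "z \<noteq> v' \<Longrightarrow> z \<in> insert v' V \<Longrightarrow> z \<in> V" for z by auto
    consider "x = v" "y = v'" | "x = v'" "y = v" | "x = v" "y \<noteq> v'" | "y = v" "x \<noteq> v'" | "x = v'" "y \<noteq> v"
      | "y = v'" "x \<noteq> v" | "x \<notin> {v, v'}" "y \<notin> {v, v'}" by blast
    then show ?thesis
    proof cases
      case 1 then show ?thesis using mult_vv v' by simp
    next
      case 2 then show ?thesis using mult_vv v' by (simp add: insert_commute)
    next
      case 3 then show ?thesis using mult_v[of y] xy V vv by (auto simp: n_def)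
    next
      case 4 then show ?thesis using mult_v[of x] xy V vv by (auto simp: n_def insert_commute mult.assoc mult.commute)
    next
      case 5 then show ?thesis using mult_v'[of y] xy v' vv by auto
    next
      case 6 then show ?thesis using mult_v'[of x] xy v' vv by (auto simp: insert_commute)
    next
      case 7 then show ?thesis using mult_other[of x y] xy by auto
    qed
  qed
  have deg': "card {e \<in> E. col e = \<kappa> \<and> x \<in> en' e} = r \<kappa> (part x) * ?w x" if x: "x \<in> insert v' V" for x \<kappa>
  proof -
    consider "x = v" | "x = v'" | "x \<noteq> v" "x \<noteq> v'" "x \<in> V" using x by blast
    then show ?thesis
    proof cases
      case 1
      have "{e \<in> E. col e = \<kappa> \<and> v \<in> en' e} = {e \<in> E. col e = \<kappa> \<and> v \<in> en e} - {e \<in> T. col e = \<kappa>}"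
        using T' vv by (auto simp: en'_def)
      moreover have "{e \<in> T. col e = \<kappa>} \<subseteq> {e \<in> E. col e = \<kappa> \<and> v \<in> en e}"
        using TS by (auto simp: S_def)
      ultimately have "card {e \<in> E. col e = \<kappa> \<and> v \<in> en' e} = r \<kappa> (part v) * n - r \<kappa> (part v)"
        using finT cardTcol deg[OF v(1)] by (simp add: card_Diff_subset n_def)
      then show ?thesis using 1 vv by (simp add: n_def diff_mult_distrib2)
    next
      case 2
      have "{e \<in> E. col e = \<kappa> \<and> v' \<in> en' e} = {e \<in> T. col e = \<kappa>}"
        using TE notv' by (auto simp: en'_def)
      then show ?thesis using 2 vv v' cardTcol by simp
    next
      case 3
      have "{e \<in> E. col e = \<kappa> \<and> x \<in> en' e} = {e \<in> E. col e = \<kappa> \<and> x \<in> en e}"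
        using 3 by (auto simp: en'_def)
      then show ?thesis using 3 deg by simp
    qed
  qed
  have conn': "(x, y) \<in> (colour_adj E col en' \<kappa>)\<^sup>*"
    if ev: "\<forall>i. even (r \<kappa> i)" and x: "x \<in> insert v' V" "r \<kappa> (part x) > 0"
      and y: "y \<in> insert v' V" "r \<kappa> (part y) > 0" for x y \<kappa>
  proof -
    let ?A = "colour_adj E col en \<kappa>" and ?B = "colour_adj E col en' \<kappa>"
    have symB: "(a, b) \<in> ?B\<^sup>* \<Longrightarrow> (b, a) \<in> ?B\<^sup>*" for a b
      using sym_rtrancl[OF sym_colour_adj] by (metis symD)
    have transB: "(a, b) \<in> ?B\<^sup>* \<Longrightarrow> (b, c) \<in> ?B\<^sup>* \<Longrightarrow> (a, c) \<in> ?B\<^sup>*" for a b c by (rule rtrancl_trans)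
    have RB: "(R \<kappa>)\<^sup>* \<subseteq> ?B\<^sup>*"
    proof (rule rtrancl_mono, rule subrelI)
      fix a b assume ab: "(a, b) \<in> R \<kappa>"
      then obtain e where e: "e \<in> E" "col e = \<kappa>" "en e = {a, b}" "a \<noteq> v" "b \<noteq> v"
        by (auto simp: R_def colour_adj_def)
      then have "e \<notin> T" using TS by (auto simp: S_def)
      then show "(a, b) \<in> ?B" using e by (auto simp: colour_adj_def en'_def)
    qed
    show ?thesis
    proof (cases "r \<kappa> (part v) = 0")
      case True
      have "{e \<in> T. col e = \<kappa>} = {}" using cardTcol[of \<kappa>] True finT by simp
      then have "?A \<subseteq> ?B" by (auto simp: colour_adj_def en'_def)
      then have "?A\<^sup>* \<subseteq> ?B\<^sup>*" by (rule rtrancl_mono)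
      moreover have "x \<noteq> v'" "y \<noteq> v'" using x y True v' by auto
      ultimately show ?thesis using conn[OF ev] x y by blast
    next
      case False
      \<comment> \<open>\<open>C\<close> consists of the edges between \<open>v\<close> and the component \<open>W\<close> that a moved edge \<open>e\<^sub>0\<close> leads to.
        It is nonempty and even, so \<open>T\<close> does not exhaust it.\<close>
      have "card {e \<in> T. col e = \<kappa>} > 0" using cardTcol False by simp
      then obtain e\<^sub>0 where e0: "e\<^sub>0 \<in> T" "col e\<^sub>0 = \<kappa>" by (auto simp: card_gt_0_iff)
      obtain z\<^sub>0 where z0: "en e\<^sub>0 = {v, z\<^sub>0}" "z\<^sub>0 \<noteq> v" "en' e\<^sub>0 = {v', z\<^sub>0}" "z\<^sub>0 \<in> V" using T'[OF e0(1)] by blast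
      define W where "W = (R \<kappa>)\<^sup>* `` {z\<^sub>0}"
      define C where "C = {e. g e = g e\<^sub>0} \<inter> S"
      have WV: "W \<subseteq> V"
      proof
        fix a assume "a \<in> W"
        then have "(z\<^sub>0, a) \<in> (R \<kappa>)\<^sup>*" by (simp add: W_def)
        then show "a \<in> V"
          using z0(4) en by (induction rule: rtrancl_induct) (auto simp: R_def colour_adj_def)
      qed
      have vW: "v \<notin> W"
      proof
        assume "v \<in> W"
        then have "(z\<^sub>0, v) \<in> (R \<kappa>)\<^sup>*" by (simp add: W_def)
        then show False using z0(2) by (cases rule: rtranclE) (auto simp: R_def)
      qed
      have "C = {e \<in> E. col e = \<kappa> \<and> v \<in> en e \<and> en e - {v} \<subseteq> W}"
      proof (intro equalityI subsetI)
        fix e assume e: "e \<in> C"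
        have "h e\<^sub>0 = {z\<^sub>0}" using z0 by (auto simp: h_def)
        have "e \<in> S" and ge: "g e = g e\<^sub>0" using e by (simp_all add: C_def)
        moreover have "col e = \<kappa>" using ge e0 by (simp add: g_def)
        moreover from this have "(R \<kappa>)\<^sup>* `` h e = W"
          using ge e0 \<open>h e\<^sub>0 = {z\<^sub>0}\<close> by (simp add: g_def W_def)
        moreover have "h e \<subseteq> (R \<kappa>)\<^sup>* `` h e" by auto
        ultimately show "e \<in> {e \<in> E. col e = \<kappa> \<and> v \<in> en e \<and> en e - {v} \<subseteq> W}"
          by (auto simp: S_def h_def)
      next
        fix e assume e: "e \<in> {e \<in> E. col e = \<kappa> \<and> v \<in> en e \<and> en e - {v} \<subseteq> W}"
        then have "e \<in> S" by (simp add: S_def)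
        then obtain z where z: "en e = {v, z}" "z \<noteq> v" using other by blast
        then have zW: "(z\<^sub>0, z) \<in> (R \<kappa>)\<^sup>*" using e by (auto simp: W_def)
        then have "(z, z\<^sub>0) \<in> (R \<kappa>)\<^sup>*" using symR by (metis symD)
        with zW have "(R \<kappa>)\<^sup>* `` {z} = W" unfolding W_def by (auto intro: rtrancl_trans)
        moreover have "h e = {z}" "h e\<^sub>0 = {z\<^sub>0}" using z z0 by (auto simp: h_def)
        ultimately show "e \<in> C" using \<open>e \<in> S\<close> e e0 by (auto simp: C_def g_def W_def)
      qed
      moreover have "even (card {e \<in> E. col e = \<kappa> \<and> v \<in> en e \<and> en e - {v} \<subseteq> W})"
      proof (rule even_component_edges[OF fin en _ WV vW])
        show "\<forall>u\<in>V. even (card {e \<in> E. col e = \<kappa> \<and> u \<in> en e})" using deg ev by simp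
        fix e a b assume e: "e \<in> E" "col e = \<kappa>" "en e = {a, b}" "a \<in> W" "b \<noteq> v"
        then have "(a, b) \<in> R \<kappa>" using vW by (auto simp: R_def colour_adj_def)
        then show "b \<in> W" using e(4) by (auto simp: W_def intro: rtrancl_into_rtrancl)
      qed
      ultimately have "even (card C)" by simp
      moreover have "e\<^sub>0 \<in> C" using e0 TS by (auto simp: C_def)
      moreover have finC: "finite C" using finS by (simp add: C_def)
      ultimately have c2: "card C \<ge> 2"
        by (metis One_nat_def Suc_1 Suc_leI card_gt_0_iff empty_iff even_Suc even_zero le_neq_implies_less odd_one)
      have "\<not> C \<subseteq> T"
      proof
        assume "C \<subseteq> T"
        then have "{e. g e = g e\<^sub>0} \<inter> T = C" using TS by (auto simp: C_def)
        then have "n * card C < card C + n" using Tg[of "g e\<^sub>0"] by (simp add: C_def)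
        moreover obtain n' c' where "n = Suc (Suc n')" "card C = Suc (Suc c')"
          using n c2 by (metis add_2_eq_Suc le_Suc_ex)
        ultimately show False by simp
      qed
      then obtain e\<^sub>1 where e1: "e\<^sub>1 \<in> S" "e\<^sub>1 \<notin> T" "g e\<^sub>1 = g e\<^sub>0" by (auto simp: C_def)
      then obtain z\<^sub>1 where z1: "en e\<^sub>1 = {v, z\<^sub>1}" "z\<^sub>1 \<noteq> v" using other by blast
      have "col e\<^sub>1 = \<kappa>" "(R \<kappa>)\<^sup>* `` {z\<^sub>1} = (R \<kappa>)\<^sup>* `` {z\<^sub>0}"
      proof -
        have "h e\<^sub>1 = {z\<^sub>1}" "h e\<^sub>0 = {z\<^sub>0}" using z1 z0 by (auto simp: h_def)
        then show "col e\<^sub>1 = \<kappa>" "(R \<kappa>)\<^sup>* `` {z\<^sub>1} = (R \<kappa>)\<^sup>* `` {z\<^sub>0}" using e1 e0 by (auto simp: g_def)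
      qed
      then have "(z\<^sub>0, z\<^sub>1) \<in> (R \<kappa>)\<^sup>*" by blast
      then have "(z\<^sub>0, z\<^sub>1) \<in> ?B\<^sup>*" using RB by blast
      moreover have "(v', z\<^sub>0) \<in> ?B" using e0 z0 TE by (auto simp: colour_adj_def)
      moreover have "(z\<^sub>1, v) \<in> ?B" using e1 z1 \<open>col e\<^sub>1 = \<kappa>\<close>
        by (auto simp: colour_adj_def en'_def S_def insert_commute)
      ultimately have v'v: "(v', v) \<in> ?B\<^sup>*" by (meson converse_rtrancl_into_rtrancl rtrancl_into_rtrancl)
      have to_v: "(u, v) \<in> ?B\<^sup>*" if u: "u \<in> insert v' V" "r \<kappa> (part u) > 0" for u
      proof (cases "u = v' \<or> u = v")
        case True then show ?thesis using v'v by auto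
      next
        case False
        then have "(u, v) \<in> ?A\<^sup>*" using conn[OF ev _ v(1)] u \<open>r \<kappa> (part v) \<noteq> 0\<close> by auto
        \<comment> \<open>Cut a walk from \<open>u\<close> to \<open>v\<close> at its first visit to \<open>v\<close>.\<close>
        then have "u = v \<or> (\<exists>e z. (u, z) \<in> (R \<kappa>)\<^sup>* \<and> e \<in> S \<and> col e = \<kappa> \<and> en e = {v, z} \<and> z \<noteq> v)"
        proof (induction rule: converse_rtrancl_induct)
          case base then show ?case by simp
        next
          case (step a b)
          obtain e where e: "e \<in> E" "col e = \<kappa>" "en e = {a, b}" using step(1) by (auto simp: colour_adj_def)
          show ?case
          proof (cases "a = v \<or> b = v")
            case True
            then show ?thesis using e by (cases "a = v") (auto simp: S_def insert_commute)
          next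
            case False
            then have "(a, b) \<in> R \<kappa>" using step(1) by (simp add: R_def)
            then show ?thesis using step(3) False by (blast intro: converse_rtrancl_into_rtrancl)
          qed
        qed
        then obtain e z where z: "(u, z) \<in> (R \<kappa>)\<^sup>*" "e \<in> S" "col e = \<kappa>" "en e = {v, z}" "z \<noteq> v"
          using False by blast
        have uz: "(u, z) \<in> ?B\<^sup>*" using z(1) RB by blast
        show ?thesis
        proof (cases "e \<in> T")
          case True
          then have "en' e = {v', z}" using z by (auto simp: en'_def)
          then have "(z, v') \<in> ?B" using z by (auto simp: colour_adj_def S_def insert_commute)
          then show ?thesis using uz v'v by (meson rtrancl_into_rtrancl rtrancl_trans)
        next
          case False
          then have "(z, v) \<in> ?B" using z by (auto simp: colour_adj_def S_def insert_commute en'_def)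
          then show ?thesis using uz by (meson rtrancl_into_rtrancl)
        qed
      qed
      show ?thesis using to_v[OF x] symB[OF to_v[OF y]] transB by blast
    qed
  qed
  have "amalgam (insert v' V) ?w en'"
    unfolding amalgam_def using fin pos v n_def n en'V mult' deg' conn' by auto
  then show ?thesis by blast
qed

lemma amalgam_cong:
  assumes "amalgam V w en" and "\<And>v. v \<in> V \<Longrightarrow> w v = w' v"
  shows "amalgam V w' en"
  using assms unfolding amalgam_def by (elim conjE; intro conjI; simp)

text \<open>As long as a vertex of \<open>U\<close> is missing, its part has a vertex of weight at least \<open>2\<close>, from which the
  missing one can be split off. In the end all weights are \<open>1\<close>, since they are positive and their
  sum over a part is the number of its vertices.\<close>

lemma split_completely:
  assumes "finite U" and "V \<subseteq> U" and "amalgam V w en"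
    and "\<And>i. (\<Sum>v | v \<in> V \<and> part v = i. w v) = card {u \<in> U. part u = i}"
  shows "\<exists>en. amalgam U (\<lambda>_. 1) en"
  using assms(2-4)
proof (induction "card (U - V)" arbitrary: V w en)
  case 0
  then have "U - V = {}" using assms(1) by simp
  then have VU: "V = U" using 0 by auto
  have "w v = 1" if v: "v \<in> V" for v
  proof -
    let ?U = "{u \<in> U. part u = part v}"
    have pos: "\<And>u. u \<in> U \<Longrightarrow> w u > 0" using 0(3) VU by (simp add: amalgam_def)
    have "(\<Sum>u\<in>?U. 1) = (\<Sum>u\<in>?U. w u)" using 0(4)[of "part v"] VU by simp
    moreover have "1 \<le> w u" if "u \<in> ?U" for u using pos[of u] that by simp
    ultimately have "1 = w v"
      by (rule sum_mono_inv) (use v VU assms(1) in auto)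
    then show ?thesis by simp
  qed
  then have "amalgam V (\<lambda>_. 1) en" using amalgam_cong[OF 0(3)] by simp
  then show ?case using VU by blast
next
  case (Suc k)
  then have "U - V \<noteq> {}" by (metis card.empty nat.distinct(1))
  then obtain u where u: "u \<in> U" "u \<notin> V" by blast
  have finV: "finite V" using assms(1) Suc.prems(1) finite_subset by blast
  let ?V = "{v \<in> V. part v = part u}"
  have "\<exists>v\<in>?V. w v \<ge> 2"
  proof (rule ccontr)
    assume "\<not> ?thesis"
    then have "(\<Sum>v\<in>?V. w v) \<le> (\<Sum>v\<in>?V. 1)" by (intro sum_mono) force
    also have "\<dots> = card ?V" by simp
    also have "\<dots> < card {x \<in> U. part x = part u}"
      using u Suc.prems(1) assms(1) by (intro psubset_card_mono) auto
    finally show False using Suc.prems(3)[of "part u"] by simp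
  qed
  then obtain v where v: "v \<in> V" "part v = part u" "w v \<ge> 2" by blast
  let ?w = "w(v := w v - 1, u := 1)"
  obtain en' where en': "amalgam (insert u V) ?w en'"
    using split_vertex[OF Suc.prems(2) v(1,3) u(2)] v(2) by auto
  have uv: "u \<noteq> v" using u v by auto
  have "(\<Sum>x | x \<in> insert u V \<and> part x = i. ?w x) = (\<Sum>x | x \<in> V \<and> part x = i. w x)" for i
  proof (cases "part u = i")
    case True
    let ?W = "{x \<in> V. part x = i} - {v}"
    have V2: "{x. x \<in> insert u V \<and> part x = i} = insert u (insert v ?W)" using v(1,2) True by blast
    have fin: "finite ?W" using finV by simp
    have nin: "v \<notin> ?W" "u \<notin> insert v ?W" using u(2) uv by simp_all
    have two: "sum f (insert u (insert v W)) = f u + (f v + sum f W)"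
      if "finite W" "v \<notin> W" "u \<notin> insert v W" for f :: "'v \<Rightarrow> nat" and W
      using that by simp
    have "(\<Sum>x | x \<in> insert u V \<and> part x = i. ?w x) = 1 + (w v - 1 + (\<Sum>x\<in>?W. ?w x))"
      unfolding V2 two[OF fin nin] using uv by simp
    also have "(\<Sum>x\<in>?W. ?w x) = (\<Sum>x\<in>?W. w x)" using u by (intro sum.cong) auto
    also have "1 + (w v - 1 + (\<Sum>x\<in>?W. w x)) = w v + (\<Sum>x\<in>?W. w x)" using v(3) by simp
    also have "\<dots> = (\<Sum>x | x \<in> V \<and> part x = i. w x)" 
      using v(1,2) True finV by (intro sum.remove[symmetric]) auto
    finally show ?thesis .
  next
    case False
    then show ?thesis using v(2) u by (intro sum.cong) auto
  qed
  then have sums: "(\<Sum>x | x \<in> insert u V \<and> part x = i. ?w x) = card {x \<in> U. part x = i}" for i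
    using Suc.prems(3) by simp
  have "U - V = insert u (U - insert u V)" using u by auto
  then have "card (U - V) = Suc (card (U - insert u V))"
    using assms(1) by (metis DiffD2 card_insert_disjoint finite_Diff insertI1)
  then have "k = card (U - insert u V)" using Suc.hyps(2) by simp
  then show ?case using Suc.hyps(1)[OF _ _ en' sums] u(1) Suc.prems(1) by blast
qed

end

section \<open>Detachment of edge colourings of multiples of complete graphs\<close>

definition base_deg :: "nat set list \<Rightarrow> nat \<Rightarrow> nat" where
  "base_deg B i = length (filter (\<lambda>p. i \<in> p) B)"

lemma base_deg_card: "base_deg B i = card {t. t < length B \<and> i \<in> B ! t}"
  by (simp add: base_deg_def length_filter_conv_card)

lemma count_list_card: "count_list xs y = card {t. t < length xs \<and> xs ! t = y}"
  by (simp add: count_list_eq_length_filter length_filter_conv_card eq_commute)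

lemma count_list_concat_nth: "count_list (concat xss) y = (\<Sum>i<length xss. count_list (xss ! i) y)"
proof -
  have "count_list (concat xss) y = (\<Sum>xs\<leftarrow>xss. count_list xs y)" by (induction xss) auto
  then show ?thesis by (simp add: sum_list_sum_nth atLeast0LessThan)
qed

text \<open>This turns a multigraph given by an abstract edge set into one whose parallel edges are numbered
  copies of a simple edge.\<close>

lemma label_parallel_edges:
  assumes "finite E" and "en ` E \<subseteq> F" and "\<And>q. q \<in> F \<Longrightarrow> card {e \<in> E. en e = q} = l"
  shows "\<exists>\<pi>. bij_betw \<pi> E (F \<times> {..<l}) \<and> (\<forall>e\<in>E. fst (\<pi> e) = en e)"
proof -
  have "\<exists>b. bij_betw b {e \<in> E. en e = q} {..<l}" if "q \<in> F" for q
    using ex_bij_betw_finite_nat[of "{e \<in> E. en e = q}"] assms(1) assms(3)[OF that]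
    by (simp add: atLeast0LessThan)
  then obtain b where b: "\<And>q. q \<in> F \<Longrightarrow> bij_betw (b q) {e \<in> E. en e = q} {..<l}" by metis
  define \<pi> where "\<pi> e = (en e, b (en e) e)" for e
  have "inj_on \<pi> E"
  proof (rule inj_onI)
    fix x y assume xy: "x \<in> E" "y \<in> E" "\<pi> x = \<pi> y"
    then have eq: "en x = en y" by (simp add: \<pi>_def)
    moreover have "b (en x) x = b (en x) y" using xy(3) eq by (simp add: \<pi>_def)
    moreover have "inj_on (b (en x)) {e \<in> E. en e = en x}"
      using b[of "en x"] assms(2) xy(1) by (auto simp: bij_betw_def)
    ultimately show "x = y" using xy by (auto simp: inj_on_def)
  qed
  moreover have "\<pi> ` E = F \<times> {..<l}"
  proof (intro equalityI subsetI)
    fix z assume "z \<in> \<pi> ` E"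
    then obtain e where e: "e \<in> E" "z = \<pi> e" by blast
    then have q: "en e \<in> F" using assms(2) by auto
    have "b (en e) e \<in> {..<l}" using bij_betwE[OF b[OF q]] e by blast
    then show "z \<in> F \<times> {..<l}" using q e by (simp add: \<pi>_def)
  next
    fix z assume "z \<in> F \<times> {..<l}"
    then obtain q k where z: "z = (q, k)" "q \<in> F" "k < l" by auto
    have "k \<in> b q ` {e \<in> E. en e = q}" using b[OF z(2)] z(3) by (simp add: bij_betw_def)
    then obtain e where "e \<in> E" "en e = q" "k = b q e" by auto
    then have "z = \<pi> e" "e \<in> E" using z by (simp_all add: \<pi>_def)
    then show "z \<in> \<pi> ` E" by blast
  qed
  ultimately show ?thesis by (intro exI[of _ \<pi>]) (simp add: bij_betw_def \<pi>_def)
qed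

text \<open>The vertices of a colour class are only those that it touches, since an isolated vertex would keep
  it from being a cycle.\<close>

lemma decomposition_of_colouring:
  assumes "finite E" and en: "en ` E \<subseteq> edges G" and mult: "\<And>q. q \<in> edges G \<Longrightarrow> card {e \<in> E. en e = q} = l"
    and G: "multigraph G" "ends G = (\<lambda>e. e)" and col: "\<And>e. e \<in> E \<Longrightarrow> col e < k"
  shows "\<exists>Ds. length Ds = k \<and> decomposition Ds (multiple l G) \<and>
    (\<forall>\<kappa><k. verts (Ds ! \<kappa>) = {v \<in> verts G. card {e \<in> E. col e = \<kappa> \<and> v \<in> en e} > 0} \<and>
       card (edges (Ds ! \<kappa>)) = card {e \<in> E. col e = \<kappa>} \<and>
       (\<forall>v. deg (Ds ! \<kappa>) v = card {e \<in> E. col e = \<kappa> \<and> v \<in> en e}) \<and>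
       adj (Ds ! \<kappa>) = colour_adj E col en \<kappa>)"
proof -
  obtain \<pi> where bij: "bij_betw \<pi> E (edges G \<times> {..<l})" and fst: "\<And>e. e \<in> E \<Longrightarrow> fst (\<pi> e) = en e"
    using label_parallel_edges[OF assms(1) en mult] by blast
  have inj: "inj_on \<pi> E" and img: "\<pi> ` E = edges G \<times> {..<l}" using bij by (auto simp: bij_betw_def)
  let ?G = "multiple l G"
  define D where "D \<kappa> = \<lparr>verts = {v \<in> verts G. card {e \<in> E. col e = \<kappa> \<and> v \<in> en e} > 0},
    edges = \<pi> ` {e \<in> E. col e = \<kappa>}, ends = ends ?G\<rparr>" for \<kappa>
  have ends: "ends ?G (\<pi> e) = en e" if "e \<in> E" for e
    using fst[OF that] by (cases "\<pi> e") (simp add: multiple_def G)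
  have card_img: "card (\<pi> ` A) = card A" if "A \<subseteq> E" for A
    using inj that by (meson card_image inj_on_subset)
  have deg: "deg (D \<kappa>) v = card {e \<in> E. col e = \<kappa> \<and> v \<in> en e}" for \<kappa> v
  proof -
    have "{q \<in> edges (D \<kappa>). v \<in> ends (D \<kappa>) q} = \<pi> ` {e \<in> E. col e = \<kappa> \<and> v \<in> en e}"
      using ends by (auto simp: D_def)
    then show ?thesis unfolding deg_def by (simp add: card_img subset_iff)
  qed
  have adj: "adj (D \<kappa>) = colour_adj E col en \<kappa>" for \<kappa>
    using ends by (auto simp: adj_def colour_adj_def D_def)
  have en_ok: "en e \<subseteq> verts G \<and> card (en e) = 2" if "e \<in> E" for e
    using G en that by (auto simp: multigraph_def)
  have sub: "subgraph (D \<kappa>) ?G" for \<kappa>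
  proof -
    have "ends ?G (\<pi> e) \<subseteq> verts (D \<kappa>) \<and> card (ends ?G (\<pi> e)) = 2" if e: "e \<in> E" "col e = \<kappa>" for e
    proof -
      have "card {e' \<in> E. col e' = \<kappa> \<and> v \<in> en e'} > 0" if "v \<in> en e" for v
        using assms(1) e that by (auto simp: card_gt_0_iff)
      then show ?thesis using ends[OF e(1)] en_ok[OF e(1)] by (auto simp: D_def)
    qed
    then have "multigraph (D \<kappa>)"
      using assms(1) G(1) by (auto simp: multigraph_def D_def)
    moreover have "verts (D \<kappa>) \<subseteq> verts ?G" by (auto simp: D_def multiple_def)
    moreover have "edges (D \<kappa>) \<subseteq> edges ?G" using img by (auto simp: D_def multiple_def)
    ultimately show ?thesis by (simp add: subgraph_def D_def)
  qed
  have dec: "decomposition (map D [0..<k]) ?G"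
    unfolding decomposition_def
  proof (intro conjI)
    show "\<forall>H\<in>set (map D [0..<k]). subgraph H ?G" using sub by simp
    have "(\<Union>H\<in>set (map D [0..<k]). edges H) = \<pi> ` (\<Union>\<kappa><k. {e \<in> E. col e = \<kappa>})"
      by (auto simp: D_def)
    moreover have "(\<Union>\<kappa><k. {e \<in> E. col e = \<kappa>}) = E" using col by auto
    ultimately show "(\<Union>H\<in>set (map D [0..<k]). edges H) = edges ?G" using img by (simp add: multiple_def)
    show "\<forall>i<length (map D [0..<k]). \<forall>j<length (map D [0..<k]). i \<noteq> j \<longrightarrow>
        edges (map D [0..<k] ! i) \<inter> edges (map D [0..<k] ! j) = {}"
      using inj by (auto simp: D_def inj_on_def)
  qed
  have "card (edges (D \<kappa>)) = card {e \<in> E. col e = \<kappa>}" for \<kappa>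
    by (simp add: D_def card_img)
  moreover have "verts (D \<kappa>) = {v \<in> verts G. card {e \<in> E. col e = \<kappa> \<and> v \<in> en e} > 0}" for \<kappa>
    by (simp add: D_def)
  ultimately show ?thesis using dec deg adj by (intro exI[of _ "map D [0..<k]"]) simp
qed

text \<open>Each \<open>B\<close> in \<open>Bs\<close> is the edge list of one colour of \<open>(l m) K\<^sub>n\<close> on the points \<open>0, \<dots>, n - 1\<close>. All
  edges are first replaced by \<open>m\<close> parallel copies, which makes \<open>m\<close> the weight of every point, and then
  every point is split completely.\<close>

theorem detachment:
  fixes Bs :: "nat set list list"
  assumes "m > 0"
    and edge: "\<And>B p. B \<in> set Bs \<Longrightarrow> p \<in> set B \<Longrightarrow> p \<subseteq> {..<n} \<and> card p = 2"
    and cover: "\<And>i j. i < n \<Longrightarrow> j < n \<Longrightarrow> i \<noteq> j \<Longrightarrow> count_list (concat Bs) {i, j} = l * m"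
    and conn: "\<And>B i j. B \<in> set Bs \<Longrightarrow> \<forall>i. even (base_deg B i) \<Longrightarrow> base_deg B i > 0 \<Longrightarrow>
      base_deg B j > 0 \<Longrightarrow> (i, j) \<in> {(x, y). {x, y} \<in> set B}\<^sup>*"
  shows "\<exists>Ds. length Ds = length Bs \<and> decomposition Ds (multiple l (complete_multipartite n m)) \<and>
    (\<forall>\<kappa><length Bs. verts (Ds ! \<kappa>) = {v \<in> {..<n} \<times> {..<m}. base_deg (Bs ! \<kappa>) (fst v) > 0} \<and>
       card (edges (Ds ! \<kappa>)) = m * length (Bs ! \<kappa>) \<and>
       (\<forall>v \<in> {..<n} \<times> {..<m}. deg (Ds ! \<kappa>) v = base_deg (Bs ! \<kappa>) (fst v)) \<and>
       ((\<forall>i. even (base_deg (Bs ! \<kappa>) i)) \<longrightarrow>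
          (\<forall>u\<in>verts (Ds ! \<kappa>). \<forall>v\<in>verts (Ds ! \<kappa>). (u, v) \<in> (adj (Ds ! \<kappa>))\<^sup>*)))"
proof -
  define k where "k = length Bs"
  \<comment> \<open>The triple \<open>(\<kappa>, t, s)\<close> is the \<open>s\<close>-th copy of the \<open>t\<close>-th edge of colour \<open>\<kappa>\<close>. The point \<open>i\<close> starts as
    the vertex \<open>(i, 0)\<close>, and \<open>(i, 1), \<dots>, (i, m - 1)\<close> are split off from it.\<close>
  define E where "E = (SIGMA \<kappa>:{..<k}. {..<length (Bs ! \<kappa>)} \<times> {..<m})"
  define col :: "nat \<times> nat \<times> nat \<Rightarrow> nat" where "col = fst"
  define e\<^sub>0 :: "nat \<times> nat \<times> nat \<Rightarrow> (nat \<times> nat) set" where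
    "e\<^sub>0 = (\<lambda>(\<kappa>, t, s). (\<lambda>i. (i, 0)) ` (Bs ! \<kappa> ! t))"
  define r where "r \<kappa> i = (if \<kappa> < k then base_deg (Bs ! \<kappa>) i else 0)" for \<kappa> i
  have finE: "finite E" by (simp add: E_def)
  interpret edge_coloured E col l "fst :: nat \<times> nat \<Rightarrow> nat" r by standard (rule finE)
  define V where "V = {..<n} \<times> {0::nat}"
  define U where "U = {..<n} \<times> {..<m}"
  have img: "(\<lambda>i. (i, 0::nat)) ` p = (\<lambda>i. (i, 0)) ` q \<longleftrightarrow> p = q" for p q :: "nat set"
    by (rule inj_image_eq_iff) (simp add: inj_on_def)
  have Bs: "Bs ! \<kappa> ! t \<subseteq> {..<n} \<and> card (Bs ! \<kappa> ! t) = 2" if "\<kappa> < k" "t < length (Bs ! \<kappa>)" for \<kappa> t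
    using edge[of "Bs ! \<kappa>" "Bs ! \<kappa> ! t"] that by (simp add: k_def)
  have "amalgam V (\<lambda>_. m) e\<^sub>0"
    unfolding amalgam_def
  proof (intro conjI ballI allI impI)
    show "finite V" by (simp add: V_def)
    show "m > 0" by (rule assms)
    fix e assume "e \<in> E"
    then obtain \<kappa> t s where e: "e = (\<kappa>, t, s)" "\<kappa> < k" "t < length (Bs ! \<kappa>)" by (auto simp: E_def)
    show "e\<^sub>0 e \<subseteq> V" using Bs[OF e(2,3)] by (auto simp: e e\<^sub>0_def V_def)
    have "card (e\<^sub>0 e) = card (Bs ! \<kappa> ! t)" unfolding e e\<^sub>0_def by (simp add: card_image inj_on_def)
    then show "card (e\<^sub>0 e) = 2" using Bs[OF e(2,3)] by simp
  next
    fix u v assume "u \<in> V" "v \<in> V" "u \<noteq> v"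
    then obtain i j where uv: "u = (i, 0)" "v = (j, 0)" "i < n" "j < n" "i \<noteq> j" by (auto simp: V_def)
    have "{u, v} = (\<lambda>i. (i, 0)) ` {i, j}" using uv by simp
    then have "{e \<in> E. e\<^sub>0 e = {u, v}} =
        (SIGMA \<kappa>:{..<k}. {t. t < length (Bs ! \<kappa>) \<and> Bs ! \<kappa> ! t = {i, j}} \<times> {..<m})"
      by (auto simp: E_def e\<^sub>0_def img simp del: image_insert)
    then have "card {e \<in> E. e\<^sub>0 e = {u, v}} = (\<Sum>\<kappa><k. count_list (Bs ! \<kappa>) {i, j} * m)"
      by (simp add: card_cartesian_product count_list_card)
    also have "\<dots> = count_list (concat Bs) {i, j} * m"
      by (simp add: count_list_concat_nth k_def sum_distrib_right)
    also have "\<dots> = l * m * m" using cover uv by simp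
    finally show "card {e \<in> E. e\<^sub>0 e = {u, v}} = (if fst u = fst v then 0 else l * m * m)"
      using uv by simp
  next
    fix v \<kappa> assume "v \<in> V"
    then obtain i where v: "v = (i, 0)" by (auto simp: V_def)
    show "card {e \<in> E. col e = \<kappa> \<and> v \<in> e\<^sub>0 e} = r \<kappa> (fst v) * m"
    proof (cases "\<kappa> < k")
      case True
      have "{e \<in> E. col e = \<kappa> \<and> v \<in> e\<^sub>0 e} = {\<kappa>} \<times> ({t. t < length (Bs ! \<kappa>) \<and> i \<in> Bs ! \<kappa> ! t} \<times> {..<m})"
        using True v by (auto simp: E_def col_def e\<^sub>0_def)
      then show ?thesis using True v by (simp add: card_cartesian_product r_def base_deg_card)
    next
      case False
      then have none: "{e \<in> E. col e = \<kappa> \<and> v \<in> e\<^sub>0 e} = {}" by (auto simp: E_def col_def)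
      show ?thesis unfolding none using False by (simp add: r_def)
    qed
  next
    fix \<kappa> u v assume ev: "\<forall>i. even (r \<kappa> i)" and uv: "u \<in> V" "v \<in> V" "r \<kappa> (fst u) > 0" "r \<kappa> (fst v) > 0"
    then have k: "\<kappa> < k" by (auto simp: r_def split: if_splits)
    obtain i j where ij: "u = (i, 0)" "v = (j, 0)" using uv by (auto simp: V_def)
    have "(i, j) \<in> {(x, y). {x, y} \<in> set (Bs ! \<kappa>)}\<^sup>*"
      using conn[of "Bs ! \<kappa>" i j] k ev uv ij by (simp add: r_def k_def)
    then have "((i, 0), (j, 0)) \<in> (colour_adj E col e\<^sub>0 \<kappa>)\<^sup>*"
    proof (induction rule: rtrancl_induct)
      case (step y z)
      then obtain t where t: "t < length (Bs ! \<kappa>)" "Bs ! \<kappa> ! t = {y, z}"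
        by (auto simp: in_set_conv_nth)
      have "(\<kappa>, t, 0) \<in> E" "col (\<kappa>, t, 0) = \<kappa>" "e\<^sub>0 (\<kappa>, t, 0) = {(y, 0), (z, 0)}"
        using t k assms(1) by (simp_all add: E_def col_def e\<^sub>0_def)
      then have "((y, 0), (z, 0)) \<in> colour_adj E col e\<^sub>0 \<kappa>" unfolding colour_adj_def by blast
      then show ?case using step(3) by (rule rtrancl_into_rtrancl[rotated])
    qed simp
    then show "(u, v) \<in> (colour_adj E col e\<^sub>0 \<kappa>)\<^sup>*" using ij by simp
  qed
  moreover have "finite U" "V \<subseteq> U" using assms(1) by (auto simp: U_def V_def)
  moreover have "(\<Sum>v | v \<in> V \<and> fst v = i. m) = card {u \<in> U. fst u = i}" for i
  proof (cases "i < n")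
    case True
    then have "{v. v \<in> V \<and> fst v = i} = {(i, 0)}" "{u \<in> U. fst u = i} = {i} \<times> {..<m}"
      by (auto simp: U_def V_def)
    then show ?thesis by (simp add: card_cartesian_product)
  next
    case False
    then have "{v. v \<in> V \<and> fst v = i} = {}" "{u \<in> U. fst u = i} = {}"
      by (auto simp: U_def V_def)
    then show ?thesis by (simp only: card.empty sum.empty)
  qed
  ultimately obtain en where am: "amalgam U (\<lambda>_. 1) en" using split_completely by blast
  have en: "\<And>e. e \<in> E \<Longrightarrow> en e \<subseteq> U \<and> card (en e) = 2"
    and mult: "\<And>u v. u \<in> U \<Longrightarrow> v \<in> U \<Longrightarrow> u \<noteq> v \<Longrightarrow>
      card {e \<in> E. en e = {u, v}} = (if fst u = fst v then 0 else l)"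
    and deg: "\<And>v \<kappa>. v \<in> U \<Longrightarrow> card {e \<in> E. col e = \<kappa> \<and> v \<in> en e} = r \<kappa> (fst v)"
    and con: "\<And>\<kappa> u v. (\<forall>i. even (r \<kappa> i)) \<Longrightarrow> u \<in> U \<Longrightarrow> v \<in> U \<Longrightarrow> r \<kappa> (fst u) > 0 \<Longrightarrow> r \<kappa> (fst v) > 0 \<Longrightarrow>
      (u, v) \<in> (colour_adj E col en \<kappa>)\<^sup>*"
    using am unfolding amalgam_def by simp_all
  let ?K = "complete_multipartite n m"
  have edgesK: "edges ?K = {{u, v} | u v. u \<in> U \<and> v \<in> U \<and> fst u \<noteq> fst v}"
    and vertsK: "verts ?K = U" and endsK: "ends ?K = (\<lambda>e. e)"
    by (simp_all add: complete_multipartite_def U_def)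
  have enK: "en ` E \<subseteq> edges ?K"
  proof
    fix q assume "q \<in> en ` E"
    then obtain e where e: "e \<in> E" "q = en e" by blast
    then obtain u v where uv: "en e = {u, v}" "u \<noteq> v" "u \<in> U" "v \<in> U" using en[OF e(1)]
      by (metis card_2_iff insert_subset)
    have "e \<in> {e \<in> E. en e = {u, v}}" using e uv by simp
    then have "{e \<in> E. en e = {u, v}} \<noteq> {}" by blast
    then have "card {e \<in> E. en e = {u, v}} > 0" using finE by (simp add: card_gt_0_iff)
    then have "fst u \<noteq> fst v" using mult[OF uv(3,4,2)] by (auto split: if_splits)
    then show "q \<in> edges ?K" using e uv edgesK by blast
  qed
  have multK: "card {e \<in> E. en e = q} = l" if q: "q \<in> edges ?K" for q
  proof -
    obtain u v where uv: "q = {u, v}" "u \<in> U" "v \<in> U" "fst u \<noteq> fst v"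
      using q unfolding edgesK by blast
    then have "u \<noteq> v" by auto
    then show ?thesis using mult[OF uv(2,3)] uv by simp
  qed
  have colk: "col e < k" if "e \<in> E" for e using that by (auto simp: E_def col_def)
  obtain Ds where Ds: "length Ds = k" "decomposition Ds (multiple l ?K)"
    "\<And>\<kappa>. \<kappa> < k \<Longrightarrow> verts (Ds ! \<kappa>) = {v \<in> verts ?K. card {e \<in> E. col e = \<kappa> \<and> v \<in> en e} > 0} \<and>
       card (edges (Ds ! \<kappa>)) = card {e \<in> E. col e = \<kappa>} \<and>
       (\<forall>v. deg (Ds ! \<kappa>) v = card {e \<in> E. col e = \<kappa> \<and> v \<in> en e}) \<and>
       adj (Ds ! \<kappa>) = colour_adj E col en \<kappa>"
    using decomposition_of_colouring[where col = col and k = k,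
        OF finE enK multK multigraph_complete_multipartite endsK colk] by auto
  show ?thesis
  proof (intro exI[of _ Ds] conjI allI impI)
    fix \<kappa> assume "\<kappa> < length Bs"
    then have k: "\<kappa> < k" by (simp add: k_def)
    have rk: "r \<kappa> = base_deg (Bs ! \<kappa>)" using k by (auto simp: r_def)
    show verts: "verts (Ds ! \<kappa>) = {v \<in> {..<n} \<times> {..<m}. base_deg (Bs ! \<kappa>) (fst v) > 0}"
      using Ds(3)[OF k] deg[of _ \<kappa>] unfolding vertsK rk by (simp add: U_def cong: conj_cong)
    have "{e \<in> E. col e = \<kappa>} = {\<kappa>} \<times> ({..<length (Bs ! \<kappa>)} \<times> {..<m})"
      using k by (auto simp: E_def col_def)
    then show "card (edges (Ds ! \<kappa>)) = m * length (Bs ! \<kappa>)"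
      using Ds(3)[OF k] by (simp add: card_cartesian_product)
    show "\<forall>v \<in> {..<n} \<times> {..<m}. deg (Ds ! \<kappa>) v = base_deg (Bs ! \<kappa>) (fst v)"
      using Ds(3)[OF k] deg[of _ \<kappa>] unfolding rk U_def by simp
    have adj: "adj (Ds ! \<kappa>) = colour_adj E col en \<kappa>" using Ds(3)[OF k] by simp
    assume "\<forall>i. even (base_deg (Bs ! \<kappa>) i)"
    then have "(u, v) \<in> (colour_adj E col en \<kappa>)\<^sup>*"
      if "u \<in> U" "v \<in> U" "base_deg (Bs ! \<kappa>) (fst u) > 0" "base_deg (Bs ! \<kappa>) (fst v) > 0" for u v
      using con[of \<kappa> u v] that unfolding rk by blast
    then show "\<forall>u\<in>verts (Ds ! \<kappa>). \<forall>v\<in>verts (Ds ! \<kappa>). (u, v) \<in> (adj (Ds ! \<kappa>))\<^sup>*"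
      unfolding verts adj U_def by blast
  qed (use Ds in \<open>simp_all add: k_def\<close>)
qed

section \<open>From base cycles to cycle decompositions\<close>

definition cycle_edges :: "'a list \<Rightarrow> 'a set list" where
  "cycle_edges xs = map2 (\<lambda>x y. {x, y}) xs (rotate1 xs)"

lemma length_cycle_edges [simp]: "length (cycle_edges xs) = length xs"
  by (simp add: cycle_edges_def)

lemma nth_cycle_edges:
  "t < length xs \<Longrightarrow> cycle_edges xs ! t = {xs ! t, xs ! (Suc t mod length xs)}"
  by (simp add: cycle_edges_def nth_rotate1)

lemma cycle_edge_valid:
  assumes "distinct xs" "length xs \<ge> 2" "p \<in> set (cycle_edges xs)"
  shows "p \<subseteq> set xs \<and> card p = 2"
proof -
  obtain t where t: "t < length xs" "p = {xs ! t, xs ! (Suc t mod length xs)}"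
    using assms(3) by (metis in_set_conv_nth length_cycle_edges nth_cycle_edges)
  have lt: "Suc t mod length xs < length xs" using assms(2) by (intro mod_less_divisor) linarith
  have "Suc t mod length xs \<noteq> t" using t(1) assms(2) by (cases "Suc t = length xs") auto
  then have "xs ! t \<noteq> xs ! (Suc t mod length xs)"
    using assms(1) t(1) lt by (simp add: nth_eq_iff_index_eq)
  then show ?thesis using t lt by auto
qed

lemma base_deg_cycle_edges:
  assumes "distinct xs" "length xs \<ge> 2"
  shows "base_deg (cycle_edges xs) i = (if i \<in> set xs then 2 else 0)"
proof (cases "i \<in> set xs")
  case True
  then obtain p where p: "p < length xs" "xs ! p = i" by (auto simp: in_set_conv_nth)
  let ?L = "length xs"
  define q where "q = (if p = 0 then ?L - 1 else p - 1)"
  have q: "q < ?L" "q \<noteq> p" "Suc q mod ?L = p" using p assms(2) by (auto simp: q_def)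
  have "i \<in> cycle_edges xs ! t \<longleftrightarrow> t = p \<or> t = q" if t: "t < ?L" for t
  proof -
    have lt: "Suc t mod ?L < ?L" using assms(2) by (intro mod_less_divisor) linarith
    have 1: "xs ! t = i \<longleftrightarrow> t = p" using assms(1) t p nth_eq_iff_index_eq by blast
    have 2: "xs ! (Suc t mod ?L) = i \<longleftrightarrow> Suc t mod ?L = p"
      using assms(1) lt p nth_eq_iff_index_eq by blast
    have 3: "Suc t mod ?L = p \<longleftrightarrow> t = q"
      using t p q_def by (cases "Suc t = ?L") auto
    show ?thesis using 1 2 3 t by (auto simp: nth_cycle_edges)
  qed
  then have "{t. t < length (cycle_edges xs) \<and> i \<in> cycle_edges xs ! t} = {p, q}"
    using p q by auto
  then show ?thesis using True q by (simp add: base_deg_card)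
next
  case False
  then have "i \<notin> p" if "p \<in> set (cycle_edges xs)" for p
    using cycle_edge_valid[OF assms that] by auto
  then have "filter (\<lambda>p. i \<in> p) (cycle_edges xs) = []" by (simp add: filter_empty_conv)
  then show ?thesis using False by (simp add: base_deg_def)
qed

lemma cycle_edges_connected:
  assumes "i \<in> set xs" "j \<in> set xs"
  shows "(i, j) \<in> {(x, y). {x, y} \<in> set (cycle_edges xs)}\<^sup>*"
proof -
  let ?R = "{(x, y). {x, y} \<in> set (cycle_edges xs)}"
  have sym: "sym (?R\<^sup>*)" by (intro sym_rtrancl) (auto simp: sym_def insert_commute)
  have from_hd: "(xs ! 0, xs ! t) \<in> ?R\<^sup>*" if "t < length xs" for t
    using that
  proof (induction t)
    case (Suc t)
    then have "cycle_edges xs ! t = {xs ! t, xs ! Suc t}" by (simp add: nth_cycle_edges)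
    moreover have "cycle_edges xs ! t \<in> set (cycle_edges xs)" using Suc by (intro nth_mem) simp
    ultimately have "(xs ! t, xs ! Suc t) \<in> ?R" by simp
    moreover have "(xs ! 0, xs ! t) \<in> ?R\<^sup>*" using Suc by simp
    ultimately show ?case by (rule rtrancl_into_rtrancl[rotated])
  qed simp
  then have "(xs ! 0, i) \<in> ?R\<^sup>*" "(xs ! 0, j) \<in> ?R\<^sup>*" using assms by (auto simp: in_set_conv_nth)
  then show ?thesis using sym by (meson rtrancl_trans symD)
qed

lemma deg_decomposition:
  assumes "decomposition Hs G" and "finite (edges G)"
  shows "deg G v = (\<Sum>i<length Hs. deg (Hs ! i) v)"
proof -
  have sub: "edges (Hs ! i) \<subseteq> edges G \<and> ends (Hs ! i) = ends G" if "i < length Hs" for i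
    using assms(1) that by (simp add: decomposition_def subgraph_def)
  have un: "(\<Union>i<length Hs. edges (Hs ! i)) = edges G"
    using assms(1) unfolding decomposition_def set_conv_nth by blast
  have "{e \<in> edges G. v \<in> ends G e} = (\<Union>i<length Hs. {e \<in> edges (Hs ! i). v \<in> ends (Hs ! i) e})"
    using sub un by auto
  also have "card \<dots> = (\<Sum>i<length Hs. card {e \<in> edges (Hs ! i). v \<in> ends (Hs ! i) e})"
  proof (rule card_UN_disjoint)
    show "\<forall>i\<in>{..<length Hs}. finite {e \<in> edges (Hs ! i). v \<in> ends (Hs ! i) e}"
      using sub assms(2) by (auto intro: finite_subset)
    show "\<forall>i\<in>{..<length Hs}. \<forall>j\<in>{..<length Hs}. i \<noteq> j \<longrightarrow>
      {e \<in> edges (Hs ! i). v \<in> ends (Hs ! i) e} \<inter> {e \<in> edges (Hs ! j). v \<in> ends (Hs ! j) e} = {}"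
      using assms(1) unfolding decomposition_def by blast
  qed simp
  finally show ?thesis by (simp add: deg_def)
qed

text \<open>The colour of a base cycle \<open>C\<close> has degree \<open>2\<close> on \<open>C\<close>, so detachment makes it a connected
  \<open>2\<close>-regular graph with \<open>m\<close> times as many edges. Whether the degrees of \<open>lK\<^bsub>n\<times>m\<^esub>\<close> are even or odd
  follows from the decomposition itself: cycles contribute even degrees, a \<open>1\<close>-factor contributes
  \<open>1\<close>.\<close>

lemma has_CD_of_base_cycles:
  assumes "m > 0"
    and cyc: "\<And>C. C \<in> set Cs \<Longrightarrow> distinct C \<and> length C \<ge> 2 \<and> set C \<subseteq> {..<n}"
    and Fs: "Fs = [] \<or> (\<exists>F. Fs = [F] \<and> (\<forall>p\<in>set F. p \<subseteq> {..<n} \<and> card p = 2) \<and> (\<forall>i<n. base_deg F i = 1))"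
    and cover: "\<And>i j. i < n \<Longrightarrow> j < n \<Longrightarrow> i \<noteq> j \<Longrightarrow>
      count_list (concat (map cycle_edges Cs @ Fs)) {i, j} = l * m"
    and lengths: "cycle_lengths ps = map (\<lambda>C. m * length C) Cs"
  shows "has_CD ps (multiple l (complete_multipartite n m))"
proof -
  let ?G = "multiple l (complete_multipartite n m)"
  define Bs where "Bs = map cycle_edges Cs @ Fs"
  define k where "k = length Cs"
  have cycB: "Bs ! \<kappa> = cycle_edges (Cs ! \<kappa>)" if "\<kappa> < k" for \<kappa>
    using that by (simp add: Bs_def k_def nth_append)
  have cycC: "distinct (Cs ! \<kappa>)" "length (Cs ! \<kappa>) \<ge> 2" "set (Cs ! \<kappa>) \<subseteq> {..<n}" if "\<kappa> < k" for \<kappa>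
    using cyc[of "Cs ! \<kappa>"] that by (simp_all add: k_def)
  have edge: "p \<subseteq> {..<n} \<and> card p = 2" if "B \<in> set Bs" "p \<in> set B" for B p
  proof -
    from that(1) consider C where "C \<in> set Cs" "B = cycle_edges C" | "B \<in> set Fs" by (auto simp: Bs_def)
    then show ?thesis
    proof cases
      case 1
      then show ?thesis using cyc[of C] cycle_edge_valid[of C p] that(2) by auto
    next
      case 2
      then show ?thesis using Fs that(2) by auto
    qed
  qed
  have conn: "(i, j) \<in> {(x, y). {x, y} \<in> set B}\<^sup>*"
    if B: "B \<in> set Bs" "\<forall>i. even (base_deg B i)" "base_deg B i > 0" "base_deg B j > 0" for B i j
  proof -
    from B(1) consider C where "C \<in> set Cs" "B = cycle_edges C" | "B \<in> set Fs" by (auto simp: Bs_def)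
    then show ?thesis
    proof cases
      case 1
      then have "i \<in> set C" "j \<in> set C"
        using B(3,4) base_deg_cycle_edges[of C] cyc[OF 1(1)] unfolding 1(2) by (metis less_numeral_extra(3))+
      from cycle_edges_connected[OF this] show ?thesis unfolding 1(2) .
    next
      case 2
      have "filter (\<lambda>p. i \<in> p) B \<noteq> []" using B(3) unfolding base_deg_def by (metis length_greater_0_conv)
      then obtain p where "p \<in> set B" "i \<in> p" unfolding filter_empty_conv by metis
      then have "i < n" using edge[OF B(1)] by blast
      then have "base_deg B i = 1" using Fs 2 by auto
      then have "odd (base_deg B i)" by simp
      then show ?thesis using B(2) by blast
    qed
  qed
  have cover': "count_list (concat Bs) {i, j} = l * m" if "i < n" "j < n" "i \<noteq> j" for i j
    using cover[OF that] by (simp add: Bs_def)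
  have "\<exists>Ds. length Ds = length Bs \<and> decomposition Ds ?G \<and> (\<forall>\<kappa><length Bs. verts (Ds ! \<kappa>) = {v \<in> {..<n} \<times> {..<m}. base_deg (Bs ! \<kappa>) (fst v) > 0} \<and>
       card (edges (Ds ! \<kappa>)) = m * length (Bs ! \<kappa>) \<and>
       (\<forall>v \<in> {..<n} \<times> {..<m}. deg (Ds ! \<kappa>) v = base_deg (Bs ! \<kappa>) (fst v)) \<and>
       ((\<forall>i. even (base_deg (Bs ! \<kappa>) i)) \<longrightarrow>
          (\<forall>u\<in>verts (Ds ! \<kappa>). \<forall>v\<in>verts (Ds ! \<kappa>). (u, v) \<in> (adj (Ds ! \<kappa>))\<^sup>*)))"
    by (intro detachment[OF assms(1)] edge cover' conn)
  then obtain Ds where Ds: "length Ds = length Bs" "decomposition Ds ?G"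
    and D': "\<forall>\<kappa><length Bs. verts (Ds ! \<kappa>) = {v \<in> {..<n} \<times> {..<m}. base_deg (Bs ! \<kappa>) (fst v) > 0} \<and>
       card (edges (Ds ! \<kappa>)) = m * length (Bs ! \<kappa>) \<and>
       (\<forall>v \<in> {..<n} \<times> {..<m}. deg (Ds ! \<kappa>) v = base_deg (Bs ! \<kappa>) (fst v)) \<and>
       ((\<forall>i. even (base_deg (Bs ! \<kappa>) i)) \<longrightarrow>
          (\<forall>u\<in>verts (Ds ! \<kappa>). \<forall>v\<in>verts (Ds ! \<kappa>). (u, v) \<in> (adj (Ds ! \<kappa>))\<^sup>*))"
    by (elim exE conjE) (rule that)
  note D = D'[rule_format]
  have vG: "verts ?G = {..<n} \<times> {..<m}" by (simp add: multiple_def complete_multipartite_def)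
  have lB: "length Bs = k + length Fs" by (simp add: Bs_def k_def)
  have sub: "subgraph (Ds ! \<kappa>) ?G" if "\<kappa> < length Bs" for \<kappa>
    using Ds that by (simp add: decomposition_def)
  have cycle: "is_cycle (m * length (Cs ! \<kappa>)) (Ds ! \<kappa>)" if k: "\<kappa> < k" for \<kappa>
  proof -
    have kB: "\<kappa> < length Bs" using k lB by simp
    note C = cycC[OF k]
    have bd: "base_deg (Bs ! \<kappa>) i = (if i \<in> set (Cs ! \<kappa>) then 2 else 0)" for i
      using base_deg_cycle_edges[OF C(1,2)] cycB[OF k] by simp
    have v: "verts (Ds ! \<kappa>) = set (Cs ! \<kappa>) \<times> {..<m}"
      using D[OF kB] C(3) by (auto simp: bd)
    have "2 \<le> m * length (Cs ! \<kappa>)" using C(2) assms(1) by (simp add: order_trans[of 2 "length (Cs ! \<kappa>)"])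
    moreover have "multigraph (Ds ! \<kappa>)" using sub[OF kB] by (simp add: subgraph_def)
    moreover have "verts (Ds ! \<kappa>) \<noteq> {}" using v assms(1) C(2) by auto
    moreover have "\<forall>u\<in>verts (Ds ! \<kappa>). \<forall>v\<in>verts (Ds ! \<kappa>). (u, v) \<in> (adj (Ds ! \<kappa>))\<^sup>*"
      using D[OF kB] bd by simp
    moreover have "regular 2 (Ds ! \<kappa>)"
      using D[OF kB] v C(3) bd by (auto simp: regular_def)
    moreover have "card (edges (Ds ! \<kappa>)) = m * length (Cs ! \<kappa>)"
      using D[OF kB] cycB[OF k] by simp
    ultimately show ?thesis by (simp add: is_cycle_def connected_graph_def)
  qed
  have factor: "one_factor (Ds ! k) ?G" if "Fs = [F]" for F
  proof -
    have kB: "k < length Bs" using that lB by simp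
    have "Bs ! k = F" using that by (simp add: Bs_def k_def nth_append)
    then have bd: "i < n \<Longrightarrow> base_deg (Bs ! k) i = 1" for i using Fs that by simp
    have "verts (Ds ! k) = verts ?G" using D[OF kB] bd vG by auto
    moreover have "regular 1 (Ds ! k)" using D[OF kB] bd by (auto simp: regular_def)
    ultimately show ?thesis using sub[OF kB] by (simp add: one_factor_def)
  qed
  define Es where "Es = drop k Ds"
  have split: "Ds = take k Ds @ Es" by (simp add: Es_def)
  have "list_all2 is_cycle (cycle_lengths ps) (take k Ds)"
    unfolding lengths using cycle Ds(1) lB by (auto simp: list_all2_conv_all_nth k_def)
  moreover have "(\<forall>v\<in>verts ?G. even (deg ?G v)) \<and> Es = [] \<or>
         (\<forall>v\<in>verts ?G. odd (deg ?G v)) \<and> (\<exists>F. Es = [F] \<and> one_factor F ?G)"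
  proof -
    have fin: "finite (edges ?G)"
      using multigraph_multiple[OF multigraph_complete_multipartite] by (simp add: multigraph_def)
    have deg: "deg ?G v = (\<Sum>\<kappa><length Bs. base_deg (Bs ! \<kappa>) (fst v))" if "v \<in> verts ?G" for v
    proof -
      have "v \<in> {..<n} \<times> {..<m}" using that vG by simp
      then have "deg (Ds ! \<kappa>) v = base_deg (Bs ! \<kappa>) (fst v)" if "\<kappa> < length Bs" for \<kappa>
        using D[OF that] by blast
      then show ?thesis unfolding deg_decomposition[OF Ds(2) fin] Ds(1) by (intro sum.cong) simp_all
    qed
    have "even (\<Sum>\<kappa><k. base_deg (Bs ! \<kappa>) i)" for i
      by (intro dvd_sum) (use base_deg_cycle_edges cycC cycB in auto)
    note even = this
    from Fs show ?thesis
    proof (elim disjE exE conjE)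
      assume "Fs = []"
      then have "length Bs = k" "Es = []" using lB Ds(1) by (simp_all add: Es_def)
      then show ?thesis using deg even by simp
    next
      fix F assume F: "Fs = [F]" and one: "\<forall>i<n. base_deg F i = 1"
      then have "length Bs = Suc k" using lB by simp
      moreover have "Bs ! k = F" using F by (simp add: Bs_def k_def nth_append)
      ultimately have "odd (deg ?G v)" if "v \<in> verts ?G" for v
        using deg[OF that] even that vG one by auto
      moreover have "Es = [Ds ! k]"
        using Ds(1) \<open>length Bs = Suc k\<close> by (simp add: Es_def Cons_nth_drop_Suc[symmetric])
      ultimately show ?thesis using factor[OF F] by blast
    qed
  qed
  moreover have "decomposition (take k Ds @ Es) ?G" using Ds(2) split by simp
  ultimately show ?thesis unfolding has_CD_def by blast
qed

section \<open>Decompositions on at most four points\<close>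

text \<open>A decomposition of \<open>L K\<^sub>n\<close> into \<open>a\<close> digons, \<open>b\<close> triangles, \<open>c\<close> quadrangles and the edges listed in
  \<open>F\<close>; \<open>F\<close> will be empty or the edge list of a \<open>1\<close>-factor. Cycles are given as lists of points, so a
  digon \<open>[i, j]\<close> covers \<open>{i, j}\<close> twice.\<close>

definition cycle_system :: "nat \<Rightarrow> nat \<Rightarrow> nat set list \<Rightarrow> nat \<Rightarrow> nat \<Rightarrow> nat \<Rightarrow> bool" where
  "cycle_system n L F a b c \<longleftrightarrow> (\<exists>As Bs Cs. length As = a \<and> length Bs = b \<and> length Cs = c \<and>
     (\<forall>C\<in>set As. distinct C \<and> length C = 2 \<and> set C \<subseteq> {..<n}) \<and>
     (\<forall>C\<in>set Bs. distinct C \<and> length C = 3 \<and> set C \<subseteq> {..<n}) \<and>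
     (\<forall>C\<in>set Cs. distinct C \<and> length C = 4 \<and> set C \<subseteq> {..<n}) \<and>
     (\<forall>i<n. \<forall>j<n. i \<noteq> j \<longrightarrow> count_list (concat (map cycle_edges (As @ Bs @ Cs)) @ F) {i, j} = L))"

lemma cycle_system_empty: "cycle_system n 0 [] 0 0 0"
  by (simp add: cycle_system_def)

lemma cycle_system_add:
  assumes "cycle_system n L F a b c" "cycle_system n L' [] a' b' c'"
  shows "cycle_system n (L + L') F (a + a') (b + b') (c + c')"
proof -
  obtain As Bs Cs where 1: "length As = a" "length Bs = b" "length Cs = c"
    "\<forall>C\<in>set As. distinct C \<and> length C = 2 \<and> set C \<subseteq> {..<n}"
    "\<forall>C\<in>set Bs. distinct C \<and> length C = 3 \<and> set C \<subseteq> {..<n}"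
    "\<forall>C\<in>set Cs. distinct C \<and> length C = 4 \<and> set C \<subseteq> {..<n}"
    "\<forall>i<n. \<forall>j<n. i \<noteq> j \<longrightarrow> count_list (concat (map cycle_edges (As @ Bs @ Cs)) @ F) {i, j} = L"
    using assms(1) unfolding cycle_system_def by blast
  obtain As' Bs' Cs' where 2: "length As' = a'" "length Bs' = b'" "length Cs' = c'"
    "\<forall>C\<in>set As'. distinct C \<and> length C = 2 \<and> set C \<subseteq> {..<n}"
    "\<forall>C\<in>set Bs'. distinct C \<and> length C = 3 \<and> set C \<subseteq> {..<n}"
    "\<forall>C\<in>set Cs'. distinct C \<and> length C = 4 \<and> set C \<subseteq> {..<n}"
    "\<forall>i<n. \<forall>j<n. i \<noteq> j \<longrightarrow> count_list (concat (map cycle_edges (As' @ Bs' @ Cs')) @ []) {i, j} = L'"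
    using assms(2) unfolding cycle_system_def by blast
  show ?thesis
    unfolding cycle_system_def
  proof (rule exI[of _ "As @ As'"], rule exI[of _ "Bs @ Bs'"], rule exI[of _ "Cs @ Cs'"],
      intro conjI allI impI)
    fix i j assume "i < n" "j < n" "i \<noteq> j"
    then have "count_list (concat (map cycle_edges (As @ Bs @ Cs)) @ F) {i, j} = L"
      "count_list (concat (map cycle_edges (As' @ Bs' @ Cs')) @ []) {i, j} = L'"
      using 1(7) 2(7) by blast+
    then show "count_list (concat (map cycle_edges ((As @ As') @ (Bs @ Bs') @ Cs @ Cs')) @ F) {i, j} = L + L'"
      by simp
  qed (use 1(1-6) 2(1-6) in auto)
qed

lemma cycle_system_times:
  assumes "cycle_system n L [] a b c"
  shows "cycle_system n (k * L) [] (k * a) (k * b) (k * c)"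
proof (induction k)
  case 0
  show ?case using cycle_system_empty by simp
next
  case (Suc k)
  then show ?case using cycle_system_add[OF assms Suc] by simp
qed

lemma cycle_systemI:
  assumes "length As = a" "length Bs = b" "length Cs = c"
    "\<forall>C\<in>set As. distinct C \<and> length C = 2 \<and> set C \<subseteq> {..<n}"
    "\<forall>C\<in>set Bs. distinct C \<and> length C = 3 \<and> set C \<subseteq> {..<n}"
    "\<forall>C\<in>set Cs. distinct C \<and> length C = 4 \<and> set C \<subseteq> {..<n}"
    "\<forall>i<n. \<forall>j<n. i \<noteq> j \<longrightarrow> count_list (concat (map cycle_edges (As @ Bs @ Cs)) @ F) {i, j} = L"
  shows "cycle_system n L F a b c"
  using assms unfolding cycle_system_def by blast

lemmas small_system_simps = cycle_edges_def numeral_eq_Suc All_less_Suc doubleton_eq_iff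

lemma systems_on_two_points:
  shows "cycle_system 2 2 [] 1 0 0" and "cycle_system 2 1 [{0, 1}] 0 0 0"
  by (rule cycle_systemI[of "[[0,1]]" _ "[]" _ "[]"]; simp add: small_system_simps)
     (rule cycle_systemI[of "[]" _ "[]" _ "[]"]; simp add: small_system_simps)

lemma systems_on_three_points:
  shows "cycle_system 3 1 [] 0 1 0" and "cycle_system 3 2 [] 3 0 0"
  by (rule cycle_systemI[of "[]" _ "[[0,1,2]]" _ "[]"]; simp add: small_system_simps)
     (rule cycle_systemI[of "[[0,1],[0,2],[1,2]]" _ "[]" _ "[]"]; simp add: small_system_simps)

text \<open>These triples \<open>(a, b, c)\<close> are all nonnegative solutions of \<open>2a + 3b + 4c = 12\<close> except \<open>(4, 0, 1)\<close>, which
  is impossible: a single quadrangle covers four pairs once, and digons do not change the parity of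
  a multiplicity. The systems consist of doubled triangles or quadrangles, of all triangles, of all
  quadrangles, or of two triangles with a common edge, which add up to a quadrangle and a doubled
  edge, and of digons that fill up the rest.\<close>

lemma systems_on_four_points:
  shows "cycle_system 4 2 [] 6 0 0" and "cycle_system 4 2 [] 2 0 2" and "cycle_system 4 2 [] 0 0 3"
    and "cycle_system 4 2 [] 3 2 0" and "cycle_system 4 2 [] 1 2 1" and "cycle_system 4 2 [] 0 4 0"
  subgoal by (rule cycle_systemI[of "[[0,1],[0,2],[0,3],[1,2],[1,3],[2,3]]" _ "[]" _ "[]"]; simp add: small_system_simps)
  subgoal by (rule cycle_systemI[of "[[0,2],[1,3]]" _ "[]" _ "[[0,1,2,3],[0,1,2,3]]"]; simp add: small_system_simps)
  subgoal by (rule cycle_systemI[of "[]" _ "[]" _ "[[0,1,2,3],[0,1,3,2],[0,2,1,3]]"]; simp add: small_system_simps)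
  subgoal by (rule cycle_systemI[of "[[0,1],[0,2],[0,3]]" _ "[[1,2,3],[1,2,3]]" _ "[]"]; simp add: small_system_simps)
  subgoal by (rule cycle_systemI[of "[[0,1]]" _ "[[1,2,3],[0,2,3]]" _ "[[0,2,1,3]]"]; simp add: small_system_simps)
  subgoal by (rule cycle_systemI[of "[]" _ "[[1,2,3],[0,2,3],[0,1,3],[0,1,2]]" _ "[]"]; simp add: small_system_simps)
  done

text \<open>The case \<open>L = 1\<close> is the quadrangle complementary to the \<open>1\<close>-factor. The three systems for \<open>L = 3\<close>
  start the cases in which removing such a quadrangle is impossible or leaves a single
  quadrangle.\<close>

lemma systems_with_factor:
  shows "cycle_system 4 1 [{0, 1}, {2, 3}] 0 0 1" and "cycle_system 4 3 [{0, 1}, {2, 3}] 4 0 2"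
    and "cycle_system 4 3 [{0, 1}, {2, 3}] 5 2 0" and "cycle_system 4 3 [{0, 1}, {2, 3}] 2 4 0"
  subgoal by (rule cycle_systemI[of "[]" _ "[]" _ "[[0,2,1,3]]"]; simp add: small_system_simps)
  subgoal by (rule cycle_systemI[of "[[1,2],[0,3],[1,3],[0,2]]" _ "[]" _ "[[0,1,2,3],[0,1,3,2]]"]; simp add: small_system_simps)
  subgoal by (rule cycle_systemI[of "[[0,1],[1,2],[1,3],[0,2],[0,3]]" _ "[[1,2,3],[0,2,3]]" _ "[]"]; simp add: small_system_simps)
  subgoal by (rule cycle_systemI[of "[[0,2],[1,2]]" _ "[[1,2,3],[0,2,3],[0,1,3],[0,1,3]]" _ "[]"]; simp add: small_system_simps)
  done

text \<open>By induction on \<open>k\<close>, one of the systems for \<open>2K\<^sub>4\<close> is peeled off. The choice takes as many triangles as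
  possible, then as many quadrangles, and deviates from this only where exactly one quadrangle and
  no triangle would remain.\<close>

lemma cycle_system_four_even:
  assumes "2 * a + 3 * b + 4 * c = 12 * k" and "(b, c) \<noteq> (0, 1)"
  shows "cycle_system 4 (2 * k) [] a b c"
  using assms
proof (induction k arbitrary: a b c)
  case 0
  then show ?case using cycle_system_empty[of 4] by simp
next
  case (Suc k)
  have peel: "cycle_system 4 (2 * Suc k) [] a b c"
    if "cycle_system 4 2 [] a' b' c'" "a' \<le> a" "b' \<le> b" "c' \<le> c"
      "2 * a' + 3 * b' + 4 * c' = 12" "b \<noteq> b' \<or> c \<noteq> c' + 1" for a' b' c'
  proof -
    from that(2-4) obtain x y z where "a = a' + x" "b = b' + y" "c = c' + z" by (auto simp: le_iff_add)
    then have "2 * (a - a') + 3 * (b - b') + 4 * (c - c') = 12 * k" using that(5) Suc.prems(1) by simp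
    moreover have "(b - b', c - c') \<noteq> (0, 1)" using that(3,4,6) by auto
    ultimately have "cycle_system 4 (2 * k) [] (a - a') (b - b') (c - c')" by (rule Suc.IH)
    from cycle_system_add[OF that(1) this] show ?thesis using that(2-4) by simp
  qed
  note S = systems_on_four_points
  have eq: "2 * a + 3 * b + 4 * c = 12 * k + 12" and not01: "b \<noteq> 0 \<or> c \<noteq> 1" using Suc.prems by auto
  have b: "b = 0 \<or> b = 2 \<or> b \<ge> 4" using eq by presburger
  have c: "c = 0 \<or> c = 1 \<or> c = 2 \<or> c = 4 \<or> c \<ge> 3 \<and> c \<noteq> 4" by linarith
  consider "b \<ge> 4" "b \<noteq> 4 \<or> c \<noteq> 1" | "b = 4" "c = 1" | "b = 2" "c = 0 \<or> c = 2"
    | "b = 2" "c \<noteq> 0" "c \<noteq> 2" | "b = 0" "c \<ge> 3" "c \<noteq> 4" | "b = 0" "c = 2 \<or> c = 4" | "b = 0" "c = 0"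
    using b c not01 by blast
  then show ?case
  proof cases
    case 1 then show ?thesis by (intro peel[OF S(6)]) auto
  next
    case 2
    then have "a \<ge> 1" using eq by presburger
    then show ?thesis using 2 by (intro peel[OF S(5)]) auto
  next
    case 3
    then have "a \<ge> 3" using eq by presburger
    then show ?thesis using 3 by (intro peel[OF S(4)]) auto
  next
    case 4
    then have "a \<ge> 1" using eq by presburger
    then show ?thesis using 4 by (intro peel[OF S(5)]) auto
  next
    case 5 then show ?thesis by (intro peel[OF S(3)]) auto
  next
    case 6
    then have "a \<ge> 2" using eq by presburger
    then show ?thesis using 6 by (intro peel[OF S(2)]) auto
  next
    case 7
    then have "a \<ge> 6" using eq by presburger
    then show ?thesis using 7 by (intro peel[OF S(1)]) auto
  qed
qed

text \<open>A system on \<open>K\<^sub>4\<close> or \<open>3K\<^sub>4\<close> takes care of the \<open>1\<close>-factor, and the rest is the even case. Without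
  triangles and quadrangles nothing could make up for the odd multiplicity of the pairs outside
  the \<open>1\<close>-factor, hence the assumption.\<close>

lemma cycle_system_four_odd:
  assumes eq: "2 * a + 3 * b + 4 * c = 12 * k + 4" and "(b, c) \<noteq> (0, 0)"
  shows "cycle_system 4 (2 * k + 1) [{0, 1}, {2, 3}] a b c"
proof -
  note S = systems_with_factor
  have peel: "cycle_system 4 (2 * k + 1) [{0, 1}, {2, 3}] a b c"
    if "cycle_system 4 3 [{0, 1}, {2, 3}] a' b' c'" "a' \<le> a" "b' \<le> b" "c' \<le> c"
      "2 * a' + 3 * b' + 4 * c' = 16" "b \<noteq> b' \<or> c \<noteq> c' + 1" for a' b' c'
  proof -
    from that(2-4) obtain x y z where xyz: "a = a' + x" "b = b' + y" "c = c' + z" by (auto simp: le_iff_add)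
    then have "12 * k \<ge> 12" using eq that(5) by linarith
    then obtain k' where k': "k = Suc k'" by (cases k) auto
    then have "2 * (a - a') + 3 * (b - b') + 4 * (c - c') = 12 * k'" using that(5) eq xyz by simp
    moreover have "(b - b', c - c') \<noteq> (0, 1)" using that(3,4,6) by auto
    ultimately have "cycle_system 4 (2 * k') [] (a - a') (b - b') (c - c')"
      by (rule cycle_system_four_even)
    from cycle_system_add[OF that(1) this] show ?thesis
      using that(2-4) k' by (simp add: eval_nat_numeral)
  qed
  have b: "b = 0 \<or> b = 2 \<or> b \<ge> 4" using eq by presburger
  have c: "c = 0 \<or> c \<ge> 1" by linarith
  consider "c \<ge> 1" "b \<noteq> 0 \<or> c \<noteq> 2" | "b = 0" "c = 2" | "b = 2" "c = 0" | "b \<ge> 4" "c = 0"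
    using b c assms(2) by blast
  then show ?thesis
  proof cases
    case 1
    have "2 * a + 3 * b + 4 * (c - 1) = 12 * k" using eq 1 by simp
    moreover have "(b, c - 1) \<noteq> (0, 1)" using 1 by auto
    ultimately have "cycle_system 4 (2 * k) [] a b (c - 1)" by (rule cycle_system_four_even)
    from cycle_system_add[OF S(1) this] show ?thesis using 1 by simp
  next
    case 2
    then have "a \<ge> 4" using eq by presburger
    then show ?thesis using 2 by (intro peel[OF S(2)]) auto
  next
    case 3
    then have "a \<ge> 5" using eq by presburger
    then show ?thesis using 3 by (intro peel[OF S(3)]) auto
  next
    case 4
    then have "a \<ge> 2" using eq by presburger
    then show ?thesis using 4 by (intro peel[OF S(4)]) auto
  qed
qed

lemma has_CD_of_cycle_system:
  assumes sys: "cycle_system n (l * m) F a b c" and "m > 0"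
    and F: "F = [] \<or> (\<forall>p\<in>set F. p \<subseteq> {..<n} \<and> card p = 2) \<and> (\<forall>i<n. base_deg F i = 1)"
    and lengths: "cycle_lengths ps = replicate a (2 * m) @ replicate b (3 * m) @ replicate c (4 * m)"
  shows "has_CD ps (multiple l (complete_multipartite n m))"
proof -
  obtain As Bs Cs where 1: "length As = a" "length Bs = b" "length Cs = c"
    "\<forall>C\<in>set As. distinct C \<and> length C = 2 \<and> set C \<subseteq> {..<n}"
    "\<forall>C\<in>set Bs. distinct C \<and> length C = 3 \<and> set C \<subseteq> {..<n}"
    "\<forall>C\<in>set Cs. distinct C \<and> length C = 4 \<and> set C \<subseteq> {..<n}"
    "\<forall>i<n. \<forall>j<n. i \<noteq> j \<longrightarrow> count_list (concat (map cycle_edges (As @ Bs @ Cs)) @ F) {i, j} = l * m"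
    using sys unfolding cycle_system_def by blast
  let ?Fs = "if F = [] then [] else [F]"
  have const: "map (\<lambda>C. m * length C) Xs = replicate (length Xs) (q * m)"
    if "\<forall>C\<in>set Xs. distinct C \<and> length C = q \<and> set C \<subseteq> {..<n}" for Xs :: "nat list list" and q
    using that by (induction Xs) auto
  show ?thesis
  proof (rule has_CD_of_base_cycles[where Cs = "As @ Bs @ Cs" and Fs = ?Fs])
    show "m > 0" by fact
    show "distinct C \<and> length C \<ge> 2 \<and> set C \<subseteq> {..<n}" if "C \<in> set (As @ Bs @ Cs)" for C
      using that 1(4-6) by auto
    show "?Fs = [] \<or> (\<exists>F. ?Fs = [F] \<and> (\<forall>p\<in>set F. p \<subseteq> {..<n} \<and> card p = 2) \<and> (\<forall>i<n. base_deg F i = 1))"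
      using F by auto
    show "count_list (concat (map cycle_edges (As @ Bs @ Cs) @ ?Fs)) {i, j} = l * m"
      if "i < n" "j < n" "i \<noteq> j" for i j
      using 1(7)[rule_format, OF that] by (cases "F = []") simp_all
    show "cycle_lengths ps = map (\<lambda>C. m * length C) (As @ Bs @ Cs)"
      using const[OF 1(4)] const[OF 1(5)] const[OF 1(6)] lengths 1(1-3) by simp
  qed
qed

theorem corollary5p4:
  fixes l m a b c :: nat
  assumes "l > 0" and "m > 0"
  shows "has_uniform_CD (2 * m) (multiple l (complete_multipartite 2 m))
    \<and> (2 * a + 3 * b = 3 * l * m \<longrightarrow>
         has_CD [(2 * m, a), (3 * m, b)] (multiple l (complete_multipartite 3 m)))
    \<and> (2 * a + 3 * b + 4 * c = 6 * l * m - (if even (l * m) then 0 else 2) \<longrightarrow>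
       (even (l * m) \<longrightarrow> (b, c) \<noteq> (0, 1)) \<longrightarrow>
       (odd (l * m) \<longrightarrow> (b, c) \<noteq> (0, 0)) \<longrightarrow>
         has_CD [(2 * m, a), (3 * m, b), (4 * m, c)] (multiple l (complete_multipartite 4 m)))"
proof (intro conjI impI)
  show "has_uniform_CD (2 * m) (multiple l (complete_multipartite 2 m))"
  proof (cases "even (l * m)")
    case True
    then obtain k where k: "l * m = 2 * k" by (rule evenE)
    have "cycle_system 2 (l * m) [] k 0 0"
      using cycle_system_times[OF systems_on_two_points(1), of k] k by (simp add: mult.commute)
    then have "has_CD [(2 * m, k)] (multiple l (complete_multipartite 2 m))"
      by (rule has_CD_of_cycle_system) (simp_all add: assms cycle_lengths_def)
    then show ?thesis unfolding has_uniform_CD_def by blast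
  next
    case False
    then obtain k where k: "l * m = 2 * k + 1" by (rule oddE)
    have "cycle_system 2 (l * m) [{0, 1}] k 0 0"
      using cycle_system_add[OF systems_on_two_points(2) cycle_system_times[OF systems_on_two_points(1), of k]] k
      by (simp add: mult.commute)
    then have "has_CD [(2 * m, k)] (multiple l (complete_multipartite 2 m))"
      by (rule has_CD_of_cycle_system) (auto simp: assms cycle_lengths_def base_deg_def less_2_cases_iff)
    then show ?thesis unfolding has_uniform_CD_def by blast
  qed
next
  assume "2 * a + 3 * b = 3 * l * m"
  then have eq: "2 * a + 3 * b = 3 * (l * m)" by simp
  moreover have "2 * a + 3 * b = 3 * t \<Longrightarrow> \<exists>k. a = k * 3" for t by presburger
  ultimately obtain k where k: "a = k * 3" by blast
  then have "l * m = b * 1 + k * 2" using eq by simp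
  then have "cycle_system 3 (l * m) [] a b 0"
    using cycle_system_add[OF cycle_system_times[OF systems_on_three_points(1), of b]
        cycle_system_times[OF systems_on_three_points(2), of k]] k by simp
  then show "has_CD [(2 * m, a), (3 * m, b)] (multiple l (complete_multipartite 3 m))"
    by (rule has_CD_of_cycle_system) (simp_all add: assms cycle_lengths_def)
next
  assume eq: "2 * a + 3 * b + 4 * c = 6 * l * m - (if even (l * m) then 0 else 2)"
    and even: "even (l * m) \<longrightarrow> (b, c) \<noteq> (0, 1)" and odd: "odd (l * m) \<longrightarrow> (b, c) \<noteq> (0, 0)"
  show "has_CD [(2 * m, a), (3 * m, b), (4 * m, c)] (multiple l (complete_multipartite 4 m))"
  proof (cases "even (l * m)")
    case True
    then obtain k where k: "l * m = 2 * k" by blast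
    have "6 * l * m = 12 * k" using k by (simp add: mult.assoc)
    then have "cycle_system 4 (l * m) [] a b c"
      unfolding k using eq even True by (intro cycle_system_four_even) simp_all
    then show ?thesis
      by (rule has_CD_of_cycle_system) (simp_all add: assms cycle_lengths_def)
  next
    case False
    then obtain k where k: "l * m = 2 * k + 1" by (rule oddE)
    have "6 * l * m = 12 * k + 6" using k by (simp add: mult.assoc)
    then have "cycle_system 4 (l * m) [{0, 1}, {2, 3}] a b c"
      unfolding k using eq odd False by (intro cycle_system_four_odd) simp_all
    then show ?thesis
      by (rule has_CD_of_cycle_system)
         (auto simp: assms cycle_lengths_def base_deg_def numeral_eq_Suc less_Suc_eq)
  qed
qed

end
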